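(* Let $[\alpha,\beta]$ be a closed and bounded interval of $\mathbb{R}$, and let $u \in C([\alpha - r, \beta], \mathbb{C}^n)$ and $v \in C([\alpha, \beta + r], (\mathbb{C}^n)')$ be given. If the restrictions $u|_{[\alpha, \beta]}$ and $v|_{[\alpha, \beta]}$ are continuously differentiable, then the function $[\alpha, \beta] \ni t \mapsto B(v^t, u_t) \in \mathbb{C}$ is continuously differentiable and satisfies $$\frac{d}{dt} B(v^t, u_t) = \left(\dot{v}(t) + \int_{-r}^0 v(t - \theta)\, d\eta(\theta)\right) u(t) + v(t) \left(\dot{u}(t) - \int_{-r}^0 d\eta(\theta)\, u(t + \theta)\right)$$ for all $t \in [\alpha, \beta]$.
   Context: Let $r>0$ and let $n$ be a positive integer. $\mathbb{C}^n$ denotes column vectors, $(\mathbb{C}^n)'$ denotes $n$-dimensional complex row vectors, $M_n(\mathbb{C})$ the $n\times n$ complex matrices. Let $\eta=(\eta_{ij})\colon [-r,0]\to M_n(\mathbb{C})$ be a function of bounded variation. Integrals against $d\eta$ are Riemann–Stieltjes integrals taken componentwise: for continuous $\phi$ (column valued) and $\psi$ (row valued), $\left(\int d\eta(\theta)\,\phi(\theta)\right)_i=\sum_j\int \phi_j(\theta)\,d\eta_{ij}(\theta)$ and $\left(\int \psi(\theta)\,d\eta(\theta)\right)_j=\sum_i\int \psi_i(\theta)\,d\eta_{ij}(\theta)$. Write $C=C([-r,0],\mathbb{C}^n)$ and $C^*=C([0,r],(\mathbb{C}^n)')$ (supremum norms). The bilinear form $B\colon C^*\times C\to\mathbb{C}$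 is $$B(\psi,\phi)=\psi(0)\phi(0)+\int_{-r}^0\left(\int_{-r}^{\xi}\psi(\xi-\theta)\,d\eta(\theta)\right)\phi(\xi)\,d\xi ,$$ where the inner integral, as a function of $\xi\in[-r,0]$, is Riemann integrable. For $t\in[\alpha,\beta]$, $u_t\in C$ and $v^t\in C^*$ are defined by $u_t(\theta)=u(t+\theta)$ for $\theta\in[-r,0]$ and $v^t(\tau)=v(t+\tau)$ for $\tau\in[0,r]$. Dots denote derivatives in $t$ of the restrictions to $[\alpha,\beta]$ (one-sided at the endpoints). *)

theory Defs
  imports "HOL-Analysis.Analysis"
begin

text \<open>
  On matrices \<^typ>\<open>complex^'n^'n\<close> the norm below is the Frobenius norm. All norms on
  this space are equivalent, so the class of functions of bounded variation does not depend on
  this choice.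
\<close>

definition bounded_variation_on :: "(real \<Rightarrow> 'a::real_normed_vector) \<Rightarrow> real \<Rightarrow> real \<Rightarrow> bool"
  where "bounded_variation_on g a b \<longleftrightarrow>
    bdd_above {(\<Sum>K\<in>d. norm (g (Sup K) - g (Inf K))) | d. d division_of {a..b}}"

text \<open>
  The Riemann--Stieltjes integral in the mesh-limit sense (the size of the subintervals, not a
  gauge, controls the sums). A tagged division may contain one-point intervals; they contribute
  nothing because their increment of the integrator vanishes.
\<close>

definition has_rs_integral ::
    "real \<Rightarrow> real \<Rightarrow> (real \<Rightarrow> complex) \<Rightarrow> (real \<Rightarrow> complex) \<Rightarrow> complex \<Rightarrow> bool"
  where "has_rs_integral a b f g I \<longleftrightarrow>
    (\<forall>\<epsilon>>0. \<exists>\<delta>>0. \<forall>p. p tagged_division_of {a..b} \<and> (\<forall>(x, K)\<in>p. Sup K - Inf K < \<delta>) \<longrightarrow>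
      norm ((\<Sum>(x, K)\<in>p. f x * (g (Sup K) - g (Inf K))) - I) < \<epsilon>)"

definition rs_integral :: "real \<Rightarrow> real \<Rightarrow> (real \<Rightarrow> complex) \<Rightarrow> (real \<Rightarrow> complex) \<Rightarrow> complex"
  where "rs_integral a b f g = (THE I. has_rs_integral a b f g I)"

text \<open>
  Row and column vectors are both represented by \<^typ>\<open>complex^'n\<close>; an entry
  \<open>\<eta>\<^sub>i\<^sub>j(\<theta>)\<close> is \<open>\<eta> \<theta> $ i $ j\<close>.
\<close>

definition rs_integral_col ::
    "real \<Rightarrow> real \<Rightarrow> (real \<Rightarrow> complex^'n^'n) \<Rightarrow> (real \<Rightarrow> complex^'n) \<Rightarrow> complex^'n"
  where "rs_integral_col a b \<eta> \<phi> =
    (\<chi> i. \<Sum>j\<in>UNIV. rs_integral a b (\<lambda>\<theta>. \<phi> \<theta> $ j) (\<lambda>\<theta>. \<eta> \<theta> $ i $ j))"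

definition rs_integral_row ::
    "real \<Rightarrow> real \<Rightarrow> (real \<Rightarrow> complex^'n) \<Rightarrow> (real \<Rightarrow> complex^'n^'n) \<Rightarrow> complex^'n"
  where "rs_integral_row a b \<psi> \<eta> =
    (\<chi> j. \<Sum>i\<in>UNIV. rs_integral a b (\<lambda>\<theta>. \<psi> \<theta> $ i) (\<lambda>\<theta>. \<eta> \<theta> $ i $ j))"

text \<open>
  The product of a row vector and a column vector. It is bilinear: there is no complex
  conjugation, unlike in the inner product.
\<close>

definition row_times_col :: "complex^'n \<Rightarrow> complex^'n \<Rightarrow> complex"  (infixl \<open>\<bullet>\<^sub>r\<^sub>c\<close> 70)
  where "x \<bullet>\<^sub>r\<^sub>c y = (\<Sum>i\<in>UNIV. x $ i * y $ i)"

text \<open>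
  Only the values of \<open>\<psi>\<close> on \<open>[0, r]\<close> and of \<open>\<phi>\<close> on \<open>[-r, 0]\<close>
  matter. The outer integral is a Riemann integral, with which the Henstock--Kurzweil
  \<^const>\<open>integral\<close> agrees.
\<close>

definition hale_form ::
    "real \<Rightarrow> (real \<Rightarrow> complex^'n^'n) \<Rightarrow> (real \<Rightarrow> complex^'n) \<Rightarrow> (real \<Rightarrow> complex^'n) \<Rightarrow> complex"
  where "hale_form r \<eta> \<psi> \<phi> =
    \<psi> 0 \<bullet>\<^sub>r\<^sub>c \<phi> 0 +
    integral {-r..0} (\<lambda>\<xi>. rs_integral_row (-r) \<xi> (\<lambda>\<theta>. \<psi> (\<xi> - \<theta>)) \<eta> \<bullet>\<^sub>r\<^sub>c \<phi> \<xi>)"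

text \<open>
  \<open>u\<^sub>t\<close> is meant on \<open>[-r, 0]\<close> and \<open>v\<^sup>t\<close> on \<open>[0, r]\<close>.
\<close>

definition history_segment :: "(real \<Rightarrow> 'a) \<Rightarrow> real \<Rightarrow> real \<Rightarrow> 'a"
  where "history_segment u t = (\<lambda>\<theta>. u (t + \<theta>))"

definition future_segment :: "(real \<Rightarrow> 'a) \<Rightarrow> real \<Rightarrow> real \<Rightarrow> 'a"
  where "future_segment v t = (\<lambda>\<tau>. v (t + \<tau>))"

end

theory Submission
  imports Defs
begin

text \<open>
  Written out, \<open>B(v\<^sup>t, u\<^sub>t)\<close> is \<open>v(t) u(t)\<close> plus the double integral of
  \<open>v(t + \<xi> - \<theta>) d\<eta>(\<theta>) u(t + \<xi>) d\<xi>\<close> over the triangle \<open>-r \<le> \<theta> \<le> \<xi> \<le> 0\<close>. The product rule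
  handles the first term. In the second, \<open>u\<close> and \<open>v\<close> are evaluated outside \<open>[\<alpha>, \<beta>]\<close>, where they are
  merely continuous, so one cannot differentiate under the integral signs; and the substitution
  \<open>s = t + \<xi>\<close> moves \<open>t\<close> into the limit \<open>s - t\<close> of the inner integral, where \<open>\<eta>\<close> may jump.
  Interchanging the integrals first turns the term into \<open>\<integral> G(t, \<theta>) d\<eta>(\<theta>)\<close>, where \<open>G(t, \<theta>)\<close> is the integral of \<open>v(s - \<theta>) u(s)\<close> for \<open>s\<close> from
  \<open>t + \<theta>\<close> to \<open>t\<close>. Now \<open>t\<close> enters through the limits alone, the \<open>t\<close>-derivative of \<open>G\<close> is
  \<open>v(t - \<theta>) u(t) - v(t) u(t + \<theta>)\<close>, and integrating this against \<open>d\<eta>\<close> gives the two integrals in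
  the formula (\<open>sliding_double_integral_derivative\<close>).

  The work lies in the interchange. For a continuous kernel on a rectangle
  (\<open>integral_rs_integral_swap\<close>) it follows from the fact that Riemann--Stieltjes sums converge
  uniformly over integrands with a common modulus of continuity (\<open>norm_rs_sum_minus_integral_le\<close>).
  The triangle is reduced to this case (\<open>rs_integral_triangle_swap\<close>) by splitting off the
  values of the kernel on the diagonal, which contribute an integral that can be treated by
  integration by parts (\<open>integral_tail_has_rs_integral\<close>).
\<close>

section \<open>Riemann--Stieltjes sums and majorants of the variation\<close>

definition rs_sum :: "(real \<Rightarrow> complex) \<Rightarrow> (real \<Rightarrow> complex) \<Rightarrow> (real \<times> real set) set \<Rightarrow> complex"
  where "rs_sum f g p = (\<Sum>(x, K)\<in>p. f x * (g (Sup K) - g (Inf K)))"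

definition mesh_below :: "real \<Rightarrow> (real \<times> real set) set \<Rightarrow> bool"
  where "mesh_below \<delta> p \<longleftrightarrow> (\<forall>(x, K)\<in>p. Sup K - Inf K < \<delta>)"

text \<open>
  The variation function of \<open>g\<close> is such a \<open>V\<close>. The estimates below use about
  \<open>g\<close> only that its increments are dominated by increments of \<open>V\<close>, and this relation passes to
  subintervals and, from a matrix valued function, to its entries with the same \<open>V\<close>.
\<close>

definition variation_majorant ::
    "(real \<Rightarrow> real) \<Rightarrow> (real \<Rightarrow> 'a::real_normed_vector) \<Rightarrow> real \<Rightarrow> real \<Rightarrow> bool"
  where "variation_majorant V g a b \<longleftrightarrow>
    (\<forall>x y. a \<le> x \<longrightarrow> x \<le> y \<longrightarrow> y \<le> b \<longrightarrow> norm (g y - g x) \<le> V y - V x)"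

lemma variation_majorantD:
  assumes "variation_majorant V g a b" "a \<le> x" "x \<le> y" "y \<le> b"
  shows "norm (g y - g x) \<le> V y - V x"
  using assms unfolding variation_majorant_def by blast

lemma variation_majorant_mono:
  assumes "variation_majorant V g a b" "a \<le> x" "x \<le> y" "y \<le> b"
  shows "V x \<le> V y"
  using variation_majorantD[OF assms] norm_ge_zero[of "g y - g x"] by linarith

lemma variation_majorant_subinterval:
  assumes "variation_majorant V g a b" "a \<le> c" "d \<le> b"
  shows "variation_majorant V g c d"
  using assms unfolding variation_majorant_def by auto

text \<open>
  \<open>V x\<close> is the variation of \<open>g\<close> over \<open>[a, x]\<close>: adjoining \<open>[x, y]\<close> to a division
  of \<open>[a, x]\<close> gives a division of \<open>[a, y]\<close>, so the variation grows by at least the norm of the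
  increment over \<open>[x, y]\<close>.
\<close>

lemma bounded_variation_imp_variation_majorant:
  assumes "bounded_variation_on g a b"
  shows "\<exists>V. variation_majorant V g a b"
proof -
  define S where "S x = {(\<Sum>K\<in>d. norm (g (Sup K) - g (Inf K))) | d. d division_of {a..x}}" for x
  have extend: "s + norm (g y - g x) \<in> S y"
    if xy: "a \<le> x" "x < y" and s: "s \<in> S x" for x y s
  proof -
    obtain d where d: "d division_of {a..x}"
        and s_eq: "s = (\<Sum>K\<in>d. norm (g (Sup K) - g (Inf K)))"
      using s unfolding S_def by auto
    have xy_div: "{{x..y}} division_of {x..y}"
      using xy division_of_self[of x y] by (simp only: box_real(2)) simp
    have "interior {a..x} \<inter> interior {x..y} = {}"
      by auto
    then have "(d \<union> {{x..y}}) division_of ({a..x} \<union> {x..y})"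
      using division_disjoint_union[OF d xy_div] by blast
    moreover have "{a..x} \<union> {x..y} = {a..y}"
      using xy by auto
    ultimately have div: "insert {x..y} d division_of {a..y}"
      by simp
    have "{x..y} \<notin> d"
    proof
      assume "{x..y} \<in> d"
      then have "{x..y} \<subseteq> {a..x}"
        by (rule division_ofD(2)[OF d])
      then show False
        using xy by auto
    qed
    moreover have "finite d"
      using division_ofD(1)[OF d] .
    ultimately have "s + norm (g y - g x) = (\<Sum>K\<in>insert {x..y} d. norm (g (Sup K) - g (Inf K)))"
      using xy by (simp add: s_eq)
    then show ?thesis
      unfolding S_def by (intro CollectI exI[of _ "insert {x..y} d"] conjI div)
  qed
  have bdd_b: "bdd_above (S b)"
    using assms unfolding bounded_variation_on_def S_def .
  have bdd: "bdd_above (S x)" if "a \<le> x" "x \<le> b" for x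
  proof (cases "x = b")
    case False
    show ?thesis
    proof (rule bdd_aboveI)
      fix s assume "s \<in> S x"
      then have "s + norm (g b - g x) \<in> S b"
        using that False by (intro extend) auto
      then have "s + norm (g b - g x) \<le> Sup (S b)"
        using bdd_b by (rule cSup_upper)
      then show "s \<le> Sup (S b)"
        using norm_ge_zero[of "g b - g x"] by linarith
    qed
  qed (use bdd_b in simp)
  have ne: "S x \<noteq> {}" if "a \<le> x" for x
  proof -
    have "{{a..x}} division_of {a..x}"
      using division_of_self[of a x] that by (simp only: box_real(2)) simp
    then show ?thesis
      unfolding S_def by blast
  qed
  have "norm (g y - g x) \<le> Sup (S y) - Sup (S x)" if "a \<le> x" "x \<le> y" "y \<le> b" for x y
  proof (cases "x = y")
    case False
    have "Sup (S x) \<le> Sup (S y) - norm (g y - g x)"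
    proof (rule cSup_least)
      fix s assume "s \<in> S x"
      then have "s + norm (g y - g x) \<in> S y"
        using that False by (intro extend) auto
      moreover have "bdd_above (S y)"
        using that by (intro bdd) auto
      ultimately have "s + norm (g y - g x) \<le> Sup (S y)"
        by (rule cSup_upper)
      then show "s \<le> Sup (S y) - norm (g y - g x)"
        by linarith
    qed (rule ne[OF that(1)])
    then show ?thesis
      by linarith
  qed simp
  then have "variation_majorant (\<lambda>x. Sup (S x)) g a b"
    unfolding variation_majorant_def by simp
  then show ?thesis
    by (rule exI[where x = "\<lambda>x. Sup (S x)"])
qed

lemma tagged_division_interval:
  fixes a b :: real
  assumes "p tagged_division_of {a..b}" "(x, K) \<in> p"
  obtains c d where "K = {c..d}" "c \<le> x" "x \<le> d" "a \<le> c" "d \<le> b" "Inf K = c" "Sup K = d"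
proof -
  obtain c d where K: "K = {c..d}"
    using tagged_division_ofD(4)[OF assms] unfolding box_real by blast
  have x: "x \<in> K" and sub: "K \<subseteq> {a..b}"
    using tagged_division_ofD(2,3)[OF assms] by auto
  have "c \<le> x" "x \<le> d"
    using x K by auto
  moreover from this have "a \<le> c" "d \<le> b"
    using sub K by auto
  ultimately show thesis
    using that[of c d] K by simp
qed

lemma sum_increments:
  fixes g :: "real \<Rightarrow> 'a::real_normed_vector"
  assumes "a \<le> b" "p tagged_division_of {a..b}"
  shows "(\<Sum>(x, K)\<in>p. g (Sup K) - g (Inf K)) = g b - g a"
  using additive_tagged_division_1[OF assms] .

lemma fine_tagged_division_exists:
  fixes a b :: real
  assumes "\<delta> > 0"
  obtains p where "p tagged_division_of {a..b}" "mesh_below \<delta> p"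
proof -
  obtain p where p: "p tagged_division_of {a..b}" and fine: "(\<lambda>x. ball x (\<delta>/2)) fine p"
    using fine_division_exists_real[OF gauge_ball, of "\<delta>/2" a b] assms by auto
  have "mesh_below \<delta> p"
    unfolding mesh_below_def
  proof safe
    fix x K assume xK: "(x, K) \<in> p"
    obtain c d where K: "K = {c..d}" "c \<le> x" "x \<le> d" "Inf K = c" "Sup K = d"
      using tagged_division_interval[OF p xK] by metis
    have "K \<subseteq> ball x (\<delta>/2)"
      using fine xK by blast
    moreover have "c \<in> K" "d \<in> K"
      using K by auto
    ultimately have "dist x c < \<delta>/2" "dist x d < \<delta>/2"
      by (auto dest: subsetD)
    then show "Sup K - Inf K < \<delta>"
      using K by (simp add: dist_real_def)
  qed
  then show thesis
    using that p by blast
qed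

text \<open>
  The increment of \<open>g\<close> over the intersection of the intervals \<open>K\<close> and \<open>L\<close>, written by
  clamping the endpoints of \<open>L\<close> to \<open>K\<close>. With this form the value for disjoint intervals is
  \<open>0\<close> without a case distinction, and a sum over all \<open>L\<close> of a division telescopes, being a
  sum of increments of the clamped function.
\<close>

definition overlap_increment :: "(real \<Rightarrow> 'a::ab_group_add) \<Rightarrow> real set \<Rightarrow> real set \<Rightarrow> 'a"
  where "overlap_increment g K L =
    g (max (Inf K) (min (Sup K) (Sup L))) - g (max (Inf K) (min (Sup K) (Inf L)))"

lemma overlap_increment_Icc:
  assumes "c \<le> d" "c' \<le> (d'::real)"
  shows "overlap_increment g {c..d} {c'..d'} =
    (if max c c' \<le> min d d' then g (min d d') - g (max c c') else 0)"
  using assms unfolding overlap_increment_def by (auto simp: max_def min_def)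

lemma overlap_increment_commute:
  assumes "c \<le> d" "c' \<le> (d'::real)"
  shows "overlap_increment g {c..d} {c'..d'} = overlap_increment g {c'..d'} {c..d}"
  using assms by (simp add: overlap_increment_Icc max.commute min.commute)

lemma sum_overlap_increment:
  fixes g :: "real \<Rightarrow> 'a::real_normed_vector"
  assumes "q tagged_division_of {a..b}" "a \<le> c" "c \<le> d" "d \<le> b"
  shows "(\<Sum>(y, L)\<in>q. overlap_increment g {c..d} L) = g d - g c"
proof -
  have "(\<Sum>(y, L)\<in>q. overlap_increment g {c..d} L) =
      g (max c (min d b)) - g (max c (min d a))"
    using sum_increments[OF _ assms(1), of "\<lambda>s. g (max c (min d s))"] assms(2-4)
    by (simp add: overlap_increment_def)
  moreover have "max c (min d b) = d" "max c (min d a) = c"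
    using assms(2-4) by auto
  ultimately show ?thesis
    by simp
qed

text \<open>
  Both sums are written over the common refinement of the two divisions. The term of a pair of
  overlapping intervals is then an increment of \<open>g\<close> times the difference of \<open>f\<close> at two
  tags that are less than two meshes apart.
\<close>

lemma rs_sum_diff_le:
  assumes V: "variation_majorant V g a b" and "a \<le> b"
    and p: "p tagged_division_of {a..b}" "mesh_below \<delta> p"
    and q: "q tagged_division_of {a..b}" "mesh_below \<delta> q"
    and osc: "\<And>x y. \<lbrakk>x \<in> {a..b}; y \<in> {a..b}; \<bar>x - y\<bar> < 2 * \<delta>\<rbrakk> \<Longrightarrow> norm (f x - f y) \<le> e"
  shows "norm (rs_sum f g p - rs_sum f g q) \<le> e * (V b - V a)"
proof -
  have over_q: "(\<Sum>(y, L)\<in>q. overlap_increment h K L) = h (Sup K) - h (Inf K)"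
    if xK: "(x, K) \<in> p" for x K and h :: "real \<Rightarrow> 'z::real_normed_vector"
  proof -
    obtain c d where K: "K = {c..d}" "c \<le> x" "x \<le> d" "a \<le> c" "d \<le> b" "Inf K = c" "Sup K = d"
      by (rule tagged_division_interval[OF p(1) xK])
    show ?thesis
      using sum_overlap_increment[OF q(1), of c d h] K by simp
  qed
  have over_p: "(\<Sum>(x, K)\<in>p. overlap_increment g K L) = g (Sup L) - g (Inf L)"
    if yL: "(y, L) \<in> q" for y L
  proof -
    obtain c d where L: "L = {c..d}" "c \<le> y" "y \<le> d" "a \<le> c" "d \<le> b" "Inf L = c" "Sup L = d"
      by (rule tagged_division_interval[OF q(1) yL])
    have "(\<Sum>(x, K)\<in>p. overlap_increment g K L) = (\<Sum>(x, K)\<in>p. overlap_increment g L K)"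
    proof (rule sum.cong[OF refl], clarify)
      fix x K assume "(x, K) \<in> p"
      then obtain c' d' where "K = {c'..d'}" "c' \<le> x" "x \<le> d'"
        using tagged_division_interval[OF p(1)] by metis
      then show "overlap_increment g K L = overlap_increment g L K"
        using overlap_increment_commute[of c' d' c d g] L by simp
    qed
    also have "\<dots> = g d - g c"
      using sum_overlap_increment[OF p(1), of c d g] L by simp
    finally show ?thesis
      using L by simp
  qed
  have Sp: "rs_sum f g p = (\<Sum>(x, K)\<in>p. \<Sum>(y, L)\<in>q. f x * overlap_increment g K L)"
    unfolding rs_sum_def
    by (rule sum.cong[OF refl]) (auto simp: over_q[symmetric] sum_distrib_left case_prod_beta)
  have "rs_sum f g q = (\<Sum>(y, L)\<in>q. \<Sum>(x, K)\<in>p. f y * overlap_increment g K L)"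
    unfolding rs_sum_def
    by (rule sum.cong[OF refl]) (auto simp: over_p[symmetric] sum_distrib_left case_prod_beta)
  also have "\<dots> = (\<Sum>(x, K)\<in>p. \<Sum>(y, L)\<in>q. f y * overlap_increment g K L)"
    unfolding case_prod_beta by (rule sum.swap)
  finally have "rs_sum f g p - rs_sum f g q =
      (\<Sum>(x, K)\<in>p. \<Sum>(y, L)\<in>q. (f x - f y) * overlap_increment g K L)"
    unfolding Sp by (simp add: case_prod_beta sum_subtractf left_diff_distrib)
  also have "norm \<dots> \<le> (\<Sum>(x, K)\<in>p. \<Sum>(y, L)\<in>q. e * overlap_increment V K L)"
    unfolding case_prod_beta
  proof (intro sum_norm_le)
    fix s t assume "s \<in> p" "t \<in> q"
    then obtain x K y L where st: "s = (x, K)" "t = (y, L)" and xK: "(x, K) \<in> p" and yL: "(y, L) \<in> q"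
      by (metis surj_pair)
    obtain c d where K: "K = {c..d}" "c \<le> x" "x \<le> d" "a \<le> c" "d \<le> b" "Inf K = c" "Sup K = d"
      by (rule tagged_division_interval[OF p(1) xK])
    obtain c' d' where L: "L = {c'..d'}" "c' \<le> y" "y \<le> d'" "a \<le> c'" "d' \<le> b" "Inf L = c'" "Sup L = d'"
      by (rule tagged_division_interval[OF q(1) yL])
    have mesh: "d - c < \<delta>" "d' - c' < \<delta>"
      using p(2) q(2) xK yL K L unfolding mesh_below_def by auto
    have eq: "overlap_increment h K L =
        (if max c c' \<le> min d d' then h (min d d') - h (max c c') else 0)"
      for h :: "real \<Rightarrow> 'z::real_normed_vector"
      unfolding K(1) L(1) by (rule overlap_increment_Icc) (use K L in linarith)+
    show "norm ((f (fst s) - f (fst t)) * overlap_increment g (snd s) (snd t))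
        \<le> e * overlap_increment V (snd s) (snd t)"
    proof (cases "max c c' \<le> min d d'")
      case True
      have "norm (f x - f y) \<le> e"
        using K L mesh True by (intro osc) auto
      moreover have "norm (g (min d d') - g (max c c')) \<le> V (min d d') - V (max c c')"
        using K L True by (intro variation_majorantD[OF V]) auto
      ultimately have "norm (f x - f y) * norm (g (min d d') - g (max c c'))
          \<le> e * (V (min d d') - V (max c c'))"
        by (intro mult_mono') auto
      then show ?thesis
        by (simp only: st fst_conv snd_conv eq True if_True norm_mult)
    next
      case False
      then show ?thesis
        by (simp only: st fst_conv snd_conv eq if_False mult_zero_right norm_zero order_refl)
    qed
  qed
  also have "\<dots> = (\<Sum>(x, K)\<in>p. e * (V (Sup K) - V (Inf K)))"
    by (rule sum.cong[OF refl]) (auto simp: over_q[symmetric] sum_distrib_left case_prod_beta)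
  also have "\<dots> = e * (V b - V a)"
    by (simp add: sum_increments[OF \<open>a \<le> b\<close> p(1), symmetric] sum_distrib_left case_prod_beta)
  finally show ?thesis .
qed

section \<open>The Riemann--Stieltjes integral of a continuous function\<close>

lemma has_rs_integral_iff_rs_sum:
  "has_rs_integral a b f g I \<longleftrightarrow>
    (\<forall>\<epsilon>>0. \<exists>\<delta>>0. \<forall>p. p tagged_division_of {a..b} \<and> mesh_below \<delta> p \<longrightarrow>
      norm (rs_sum f g p - I) < \<epsilon>)"
  unfolding has_rs_integral_def rs_sum_def mesh_below_def ..

lemma has_rs_integralD:
  assumes "has_rs_integral a b f g I" "\<epsilon> > 0"
  obtains \<delta> where "\<delta> > 0"
    "\<And>p. \<lbrakk>p tagged_division_of {a..b}; mesh_below \<delta> p\<rbrakk> \<Longrightarrow> norm (rs_sum f g p - I) < \<epsilon>"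
  using assms unfolding has_rs_integral_iff_rs_sum by metis

lemma mesh_below_mono: "\<lbrakk>mesh_below \<delta> p; \<delta> \<le> \<delta>'\<rbrakk> \<Longrightarrow> mesh_below \<delta>' p"
  unfolding mesh_below_def by fastforce

lemma eq_if_norm_diff_le_mult:
  fixes x y :: "'a::real_normed_vector"
  assumes le: "\<And>e. e > 0 \<Longrightarrow> norm (x - y) \<le> e * C"
  shows "x = y"
proof -
  have "norm (x - y) \<le> 0 + e" if "e > 0" for e
  proof -
    have "norm (x - y) \<le> (e / (\<bar>C\<bar> + 1)) * C"
      using that by (intro le) (simp add: add_nonneg_pos)
    also have "\<dots> \<le> (e / (\<bar>C\<bar> + 1)) * (\<bar>C\<bar> + 1)"
      using that by (intro mult_left_mono) auto
    also have "\<dots> = e"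
      by (simp add: add_nonneg_eq_0_iff)
    finally show ?thesis
      by simp
  qed
  then show ?thesis
    using field_le_epsilon by (metis eq_iff_diff_eq_0 norm_le_zero_iff)
qed

lemma has_rs_integral_near:
  assumes "has_rs_integral a b f g I" "\<epsilon> > 0" "\<delta> > 0"
  obtains p where "p tagged_division_of {a..b}" "mesh_below \<delta> p" "norm (rs_sum f g p - I) < \<epsilon>"
proof -
  obtain \<delta>' where \<delta>': "\<delta>' > 0"
      "\<And>p. \<lbrakk>p tagged_division_of {a..b}; mesh_below \<delta>' p\<rbrakk> \<Longrightarrow> norm (rs_sum f g p - I) < \<epsilon>"
    by (rule has_rs_integralD[OF assms(1,2)]) blast
  obtain p where p: "p tagged_division_of {a..b}" "mesh_below (min \<delta> \<delta>') p"
    using fine_tagged_division_exists[of "min \<delta> \<delta>'" a b] assms(3) \<delta>'(1) by auto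
  then show thesis
    using that \<delta>'(2) mesh_below_mono by (meson min.cobounded1 min.cobounded2)
qed

lemma has_rs_integral_unique:
  assumes I: "has_rs_integral a b f g I" and J: "has_rs_integral a b f g J"
  shows "I = J"
proof (rule eq_if_norm_diff_le_mult)
  fix e :: real assume "e > 0"
  obtain \<delta> where \<delta>: "\<delta> > 0"
      "\<And>p. \<lbrakk>p tagged_division_of {a..b}; mesh_below \<delta> p\<rbrakk> \<Longrightarrow> norm (rs_sum f g p - I) < e"
    by (rule has_rs_integralD[OF I \<open>e > 0\<close>]) blast
  obtain p where "p tagged_division_of {a..b}" "mesh_below \<delta> p" "norm (rs_sum f g p - J) < e"
    by (rule has_rs_integral_near[OF J \<open>e > 0\<close> \<delta>(1)])
  with \<delta>(2)[of p] show "norm (I - J) \<le> e * 2"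
    using norm_triangle_ineq4[of "rs_sum f g p - J" "rs_sum f g p - I"] by simp
qed

lemma rs_integral_unique: "has_rs_integral a b f g I \<Longrightarrow> rs_integral a b f g = I"
  unfolding rs_integral_def by (blast intro: has_rs_integral_unique)

text \<open>
  The error of a Riemann--Stieltjes sum depends on \<open>f\<close> only through its modulus of continuity,
  hence is uniform over a family of integrands with a common modulus. The interchange of
  integrals rests on this.
\<close>

lemma norm_rs_sum_minus_integral_le:
  assumes I: "has_rs_integral a b f g I"
    and V: "variation_majorant V g a b" and "a \<le> b"
    and p: "p tagged_division_of {a..b}" "mesh_below \<delta> p" and "\<delta> > 0"
    and osc: "\<And>x y. \<lbrakk>x \<in> {a..b}; y \<in> {a..b}; \<bar>x - y\<bar> < 2 * \<delta>\<rbrakk> \<Longrightarrow> norm (f x - f y) \<le> e"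
  shows "norm (rs_sum f g p - I) \<le> e * (V b - V a)"
proof (rule field_le_epsilon)
  fix e' :: real assume "e' > 0"
  obtain q where q: "q tagged_division_of {a..b}" "mesh_below \<delta> q" "norm (rs_sum f g q - I) < e'"
    by (rule has_rs_integral_near[OF I \<open>e' > 0\<close> \<open>\<delta> > 0\<close>])
  have "norm (rs_sum f g p - rs_sum f g q) \<le> e * (V b - V a)"
    by (rule rs_sum_diff_le[OF V \<open>a \<le> b\<close> p q(1,2) osc])
  then show "norm (rs_sum f g p - I) \<le> e * (V b - V a) + e'"
    using q(3) norm_triangle_ineq[of "rs_sum f g p - rs_sum f g q" "rs_sum f g q - I"] by simp
qed

lemma continuous_on_Icc_oscillation:
  fixes f :: "real \<Rightarrow> 'a::real_normed_vector"
  assumes "continuous_on {a..b} f" "e > 0"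
  obtains \<delta> where "\<delta> > 0"
    "\<And>x y. \<lbrakk>x \<in> {a..b}; y \<in> {a..b}; \<bar>x - y\<bar> < 2 * \<delta>\<rbrakk> \<Longrightarrow> norm (f x - f y) \<le> e"
proof -
  have "uniformly_continuous_on {a..b} f"
    using assms(1) by (simp add: compact_uniformly_continuous)
  then obtain d where "d > 0" "\<And>x y. \<lbrakk>x \<in> {a..b}; y \<in> {a..b}; dist y x < d\<rbrakk> \<Longrightarrow> dist (f y) (f x) < e"
    unfolding uniformly_continuous_on_def using assms(2) by metis
  then show thesis
    using that[of "d / 2"] by (force simp: dist_norm less_imp_le)
qed

text \<open>
  The sums along divisions with meshes \<open>1, 1/2, 1/3, \<dots>\<close> form a Cauchy sequence, because two
  sums of small mesh are close; for the same reason its limit is approached by all sums of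
  small mesh.
\<close>

lemma has_rs_integral_continuous:
  assumes f: "continuous_on {a..b} f" and V: "variation_majorant V g a b" and "a \<le> b"
  shows "\<exists>I. has_rs_integral a b f g I"
proof -
  \<comment> \<open>The summand \<open>1\<close> keeps the divisor \<open>M\<close> positive when \<open>V\<close> is constant.\<close>
  define M where "M = V b - V a + 1"
  have "M > 0"
    using variation_majorant_mono[OF V, of a b] \<open>a \<le> b\<close> unfolding M_def by simp
  define P where "P n = (SOME p. p tagged_division_of {a..b} \<and> mesh_below (inverse (real (Suc n))) p)" for n
  have P: "P n tagged_division_of {a..b}" "mesh_below (inverse (real (Suc n))) (P n)" for n
  proof -
    have "\<exists>p. p tagged_division_of {a..b} \<and> mesh_below (inverse (real (Suc n))) p"
      by (rule fine_tagged_division_exists[of "inverse (real (Suc n))" a b]) auto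
    then show "P n tagged_division_of {a..b}" "mesh_below (inverse (real (Suc n))) (P n)"
      unfolding P_def by (metis (mono_tags, lifting) someI_ex)+
  qed
  have close: "\<exists>\<delta>>0. \<forall>p q. p tagged_division_of {a..b} \<and> mesh_below \<delta> p \<and>
      q tagged_division_of {a..b} \<and> mesh_below \<delta> q \<longrightarrow> norm (rs_sum f g p - rs_sum f g q) < e"
    if "e > 0" for e
  proof -
    have "e / M > 0"
      using that \<open>M > 0\<close> by simp
    obtain \<delta> where \<delta>: "\<delta> > 0"
      "\<And>x y. \<lbrakk>x \<in> {a..b}; y \<in> {a..b}; \<bar>x - y\<bar> < 2 * \<delta>\<rbrakk> \<Longrightarrow> norm (f x - f y) \<le> e / M"
      by (rule continuous_on_Icc_oscillation[OF f \<open>e / M > 0\<close>]) blast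
    have "e / M * (V b - V a) < e"
    proof -
      have "e / M * (V b - V a) < e / M * M"
        using \<open>e / M > 0\<close> by (intro mult_strict_left_mono) (auto simp: M_def)
      then show ?thesis
        using \<open>M > 0\<close> by simp
    qed
    then have "norm (rs_sum f g p - rs_sum f g q) < e"
      if "p tagged_division_of {a..b}" "mesh_below \<delta> p" "q tagged_division_of {a..b}" "mesh_below \<delta> q" for p q
    proof -
      have "norm (rs_sum f g p - rs_sum f g q) \<le> e / M * (V b - V a)"
        by (rule rs_sum_diff_le[OF V \<open>a \<le> b\<close> that]) (rule \<delta>(2))
      then show ?thesis
        using \<open>e / M * (V b - V a) < e\<close> by linarith
    qed
    then show ?thesis
      using \<delta>(1) by blast
  qed
  have eventually_fine: "\<exists>N. \<forall>n\<ge>N. mesh_below \<delta> (P n)" if "\<delta> > 0" for \<delta>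
  proof -
    obtain N where "inverse (real (Suc N)) < \<delta>"
      using reals_Archimedean[OF \<open>\<delta> > 0\<close>] by blast
    then have "inverse (real (Suc n)) \<le> \<delta>" if "n \<ge> N" for n
      using le_imp_inverse_le[of "real (Suc N)" "real (Suc n)"] \<open>n \<ge> N\<close>
        \<open>inverse (real (Suc N)) < \<delta>\<close> by (simp only: of_nat_le_iff Suc_le_mono of_nat_0_less_iff) linarith
    then show ?thesis
      using P(2) mesh_below_mono by blast
  qed
  have "Cauchy (\<lambda>n. rs_sum f g (P n))"
  proof (rule metric_CauchyI)
    fix e :: real assume "e > 0"
    from close[OF this] eventually_fine
    show "\<exists>N. \<forall>m\<ge>N. \<forall>n\<ge>N. dist (rs_sum f g (P m)) (rs_sum f g (P n)) < e"
      unfolding dist_norm using P(1) by meson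
  qed
  then obtain I where I: "(\<lambda>n. rs_sum f g (P n)) \<longlonglongrightarrow> I"
    using Cauchy_convergent convergent_def by blast
  have "has_rs_integral a b f g I"
    unfolding has_rs_integral_iff_rs_sum
  proof (intro allI impI)
    fix e :: real assume "e > 0"
    then obtain \<delta> where \<delta>: "\<delta> > 0" "\<And>p q. \<lbrakk>p tagged_division_of {a..b}; mesh_below \<delta> p;
        q tagged_division_of {a..b}; mesh_below \<delta> q\<rbrakk> \<Longrightarrow> norm (rs_sum f g p - rs_sum f g q) < e / 2"
      using close[of "e / 2"] half_gt_zero by meson
    obtain N where N: "\<And>n. n \<ge> N \<Longrightarrow> mesh_below \<delta> (P n)"
      using eventually_fine[OF \<delta>(1)] by blast
    have "norm (rs_sum f g p - I) < e" if p: "p tagged_division_of {a..b}" "mesh_below \<delta> p" for p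
    proof -
      have "norm (rs_sum f g p - I) \<le> e / 2"
      proof (rule Lim_norm_ubound)
        show "(\<lambda>n. rs_sum f g p - rs_sum f g (P n)) \<longlonglongrightarrow> rs_sum f g p - I"
          by (intro tendsto_intros I)
        show "\<forall>\<^sub>F n in sequentially. norm (rs_sum f g p - rs_sum f g (P n)) \<le> e / 2"
          using \<delta>(2)[OF p P(1) N] by (auto simp: eventually_sequentially intro!: exI[of _ N] less_imp_le)
      qed simp
      then show ?thesis
        using \<open>e > 0\<close> by linarith
    qed
    then show "\<exists>\<delta>>0. \<forall>p. p tagged_division_of {a..b} \<and> mesh_below \<delta> p \<longrightarrow> norm (rs_sum f g p - I) < e"
      using \<delta>(1) by blast
  qed
  then show ?thesis ..
qed

lemma has_rs_integral_rs_integral: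
  assumes "continuous_on {a..b} f" "variation_majorant V g a b" "a \<le> b"
  shows "has_rs_integral a b f g (rs_integral a b f g)"
  using has_rs_integral_continuous[OF assms] rs_integral_unique by metis

lemma rs_sum_cong:
  assumes "p tagged_division_of {a..b}" "\<And>x. x \<in> {a..b} \<Longrightarrow> f x = f' x"
  shows "rs_sum f g p = rs_sum f' g p"
  unfolding rs_sum_def
proof (rule sum.cong[OF refl], clarify)
  fix x K assume "(x, K) \<in> p"
  from tag_in_interval[OF assms(1) this] show "f x * (g (Sup K) - g (Inf K)) = f' x * (g (Sup K) - g (Inf K))"
    using assms(2) by auto
qed

lemma has_rs_integral_cong:
  assumes "\<And>x. x \<in> {a..b} \<Longrightarrow> f x = f' x"
  shows "has_rs_integral a b f g I \<longleftrightarrow> has_rs_integral a b f' g I"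
proof -
  have eq: "rs_sum f g p = rs_sum f' g p" if "p tagged_division_of {a..b}" for p
    using rs_sum_cong[OF that assms] .
  have "(p tagged_division_of {a..b} \<and> mesh_below \<delta> p \<longrightarrow> norm (rs_sum f g p - I) < \<epsilon>) =
      (p tagged_division_of {a..b} \<and> mesh_below \<delta> p \<longrightarrow> norm (rs_sum f' g p - I) < \<epsilon>)" for p \<delta> \<epsilon>
    using eq[of p] by auto
  then show ?thesis
    unfolding has_rs_integral_iff_rs_sum by presburger
qed

lemma has_rs_integral_add:
  assumes "has_rs_integral a b f g I" "has_rs_integral a b f' g I'"
  shows "has_rs_integral a b (\<lambda>x. f x + f' x) g (I + I')"
  unfolding has_rs_integral_iff_rs_sum
proof (intro allI impI)
  fix e :: real assume "e > 0"
  then have "e / 2 > 0"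
    by simp
  obtain \<delta> where \<delta>: "\<delta> > 0"
      "\<And>p. \<lbrakk>p tagged_division_of {a..b}; mesh_below \<delta> p\<rbrakk> \<Longrightarrow> norm (rs_sum f g p - I) < e / 2"
    by (rule has_rs_integralD[OF assms(1) \<open>e / 2 > 0\<close>]) blast
  obtain \<delta>' where \<delta>': "\<delta>' > 0"
      "\<And>p. \<lbrakk>p tagged_division_of {a..b}; mesh_below \<delta>' p\<rbrakk> \<Longrightarrow> norm (rs_sum f' g p - I') < e / 2"
    by (rule has_rs_integralD[OF assms(2) \<open>e / 2 > 0\<close>]) blast
  have "norm (rs_sum (\<lambda>x. f x + f' x) g p - (I + I')) < e"
    if p: "p tagged_division_of {a..b}" "mesh_below (min \<delta> \<delta>') p" for p
  proof -
    have "rs_sum (\<lambda>x. f x + f' x) g p = rs_sum f g p + rs_sum f' g p"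
      unfolding rs_sum_def by (simp add: case_prod_beta distrib_right sum.distrib)
    moreover have "norm (rs_sum f g p - I) < e / 2" "norm (rs_sum f' g p - I') < e / 2"
      using \<delta>(2) \<delta>'(2) p mesh_below_mono by (meson min.cobounded1 min.cobounded2)+
    ultimately show ?thesis
      using norm_triangle_ineq[of "rs_sum f g p - I" "rs_sum f' g p - I'"] by (simp add: add_diff_add)
  qed
  then show "\<exists>\<delta>>0. \<forall>p. p tagged_division_of {a..b} \<and> mesh_below \<delta> p \<longrightarrow>
      norm (rs_sum (\<lambda>x. f x + f' x) g p - (I + I')) < e"
    using \<delta>(1) \<delta>'(1) by (intro exI[of _ "min \<delta> \<delta>'"]) auto
qed

lemma has_rs_integral_cmult:
  assumes "has_rs_integral a b f g I"
  shows "has_rs_integral a b (\<lambda>x. c * f x) g (c * I)"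
  unfolding has_rs_integral_iff_rs_sum
proof (intro allI impI)
  fix e :: real assume "e > 0"
  then have "e / (norm c + 1) > 0"
    by (simp add: add_nonneg_pos)
  from assms this obtain \<delta> where \<delta>: "\<delta> > 0"
      "\<And>p. \<lbrakk>p tagged_division_of {a..b}; mesh_below \<delta> p\<rbrakk> \<Longrightarrow> norm (rs_sum f g p - I) < e / (norm c + 1)"
    by (rule has_rs_integralD) blast
  have "norm (rs_sum (\<lambda>x. c * f x) g p - c * I) < e"
    if p: "p tagged_division_of {a..b}" "mesh_below \<delta> p" for p
  proof -
    have "rs_sum (\<lambda>x. c * f x) g p - c * I = c * (rs_sum f g p - I)"
      unfolding rs_sum_def by (simp add: case_prod_beta sum_distrib_left algebra_simps)
    then have "norm (rs_sum (\<lambda>x. c * f x) g p - c * I) \<le> (norm c + 1) * norm (rs_sum f g p - I)"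
      by (simp add: norm_mult distrib_right)
    also have "\<dots> < (norm c + 1) * (e / (norm c + 1))"
      using \<delta>(2)[OF p] by (intro mult_strict_left_mono) (auto simp: add_nonneg_pos)
    also have "\<dots> = e"
      by (simp add: add_nonneg_eq_0_iff)
    finally show ?thesis .
  qed
  then show "\<exists>\<delta>>0. \<forall>p. p tagged_division_of {a..b} \<and> mesh_below \<delta> p \<longrightarrow>
      norm (rs_sum (\<lambda>x. c * f x) g p - c * I) < e"
    using \<delta>(1) by blast
qed

lemma norm_has_rs_integral_le:
  assumes I: "has_rs_integral a b f g I" and V: "variation_majorant V g a b" and "a \<le> b"
    and f: "\<And>x. x \<in> {a..b} \<Longrightarrow> norm (f x) \<le> B"
  shows "norm I \<le> B * (V b - V a)"
proof (rule field_le_epsilon)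
  fix e :: real assume "e > 0"
  obtain p where p: "p tagged_division_of {a..b}" "norm (rs_sum f g p - I) < e"
    by (rule has_rs_integral_near[OF I \<open>e > 0\<close> zero_less_one])
  have "norm (rs_sum f g p) \<le> (\<Sum>(x, K)\<in>p. B * (V (Sup K) - V (Inf K)))"
    unfolding rs_sum_def case_prod_beta
  proof (intro sum_norm_le)
    fix s assume "s \<in> p"
    then obtain x K where s: "s = (x, K)" and xK: "(x, K) \<in> p"
      by (metis surj_pair)
    obtain c d where K: "K = {c..d}" "c \<le> x" "x \<le> d" "a \<le> c" "d \<le> b" "Inf K = c" "Sup K = d"
      by (rule tagged_division_interval[OF p(1) xK])
    have "norm (g d - g c) \<le> V d - V c"
      using K by (intro variation_majorantD[OF V]) auto
    then show "norm (f (fst s) * (g (Sup (snd s)) - g (Inf (snd s)))) \<le> B * (V (Sup (snd s)) - V (Inf (snd s)))"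
      using f[of x] K by (auto simp: s norm_mult intro!: mult_mono intro: order_trans[OF norm_ge_zero])
  qed
  also have "\<dots> = B * (V b - V a)"
    by (simp add: sum_increments[OF \<open>a \<le> b\<close> p(1), symmetric] sum_distrib_left case_prod_beta)
  finally show "norm I \<le> B * (V b - V a) + e"
    using p(2) norm_triangle_ineq2[of I "rs_sum f g p"] by (simp add: norm_minus_commute)
qed

text \<open>
  Fine divisions of the two parts unite to a fine division of the whole. An element common to
  both can only be the one-point interval \<open>{c}\<close>, whose increment is \<open>0\<close>, so no term is
  lost or counted twice.
\<close>

lemma has_rs_integral_combine:
  assumes "a \<le> c" "c \<le> b"
    and I: "has_rs_integral a c f g I" and J: "has_rs_integral c b f g J"
    and H: "has_rs_integral a b f g H"
  shows "H = I + J"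
proof (rule eq_if_norm_diff_le_mult)
  fix e :: real assume "e > 0"
  obtain \<delta> where \<delta>: "\<delta> > 0"
      "\<And>p. \<lbrakk>p tagged_division_of {a..b}; mesh_below \<delta> p\<rbrakk> \<Longrightarrow> norm (rs_sum f g p - H) < e"
    by (rule has_rs_integralD[OF H \<open>e > 0\<close>]) blast
  obtain p where p: "p tagged_division_of {a..c}" "mesh_below \<delta> p" "norm (rs_sum f g p - I) < e"
    by (rule has_rs_integral_near[OF I \<open>e > 0\<close> \<delta>(1)])
  obtain q where q: "q tagged_division_of {c..b}" "mesh_below \<delta> q" "norm (rs_sum f g q - J) < e"
    by (rule has_rs_integral_near[OF J \<open>e > 0\<close> \<delta>(1)])
  have "p \<union> q tagged_division_of {a..c} \<union> {c..b}"
    by (rule tagged_division_Un[OF p(1) q(1)]) auto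
  moreover have "{a..c} \<union> {c..b} = {a..b}"
    using assms(1,2) by auto
  moreover have "mesh_below \<delta> (p \<union> q)"
    using p(2) q(2) unfolding mesh_below_def by auto
  ultimately have "norm (rs_sum f g (p \<union> q) - H) < e"
    using \<delta>(2) by simp
  moreover have "rs_sum f g (p \<union> q) = rs_sum f g p + rs_sum f g q"
    unfolding rs_sum_def
  proof (rule sum.union_inter_neutral)
    show "finite p" "finite q"
      using p(1) q(1) by auto
    show "\<forall>s\<in>p \<inter> q. (case s of (x, K) \<Rightarrow> f x * (g (Sup K) - g (Inf K))) = 0"
    proof safe
      fix x K assume "(x, K) \<in> p" "(x, K) \<in> q"
      then have "x \<in> K" "K \<subseteq> {a..c}" "K \<subseteq> {c..b}"
        using tagged_division_ofD(2,3)[OF p(1)] tagged_division_ofD(3)[OF q(1)] by auto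
      then have "K = {c}"
        by force
      then show "f x * (g (Sup K) - g (Inf K)) = 0"
        by simp
    qed
  qed
  ultimately show "norm (H - (I + J)) \<le> e * 3"
    using p(3) q(3) norm_triangle_ineq4[of "(rs_sum f g p - I) + (rs_sum f g q - J)" "rs_sum f g (p \<union> q) - H"]
      norm_triangle_ineq[of "rs_sum f g p - I" "rs_sum f g q - J"] by (simp add: algebra_simps)
qed

lemma has_rs_integral_diff:
  assumes "has_rs_integral a b f g I" "has_rs_integral a b f' g I'"
  shows "has_rs_integral a b (\<lambda>x. f x - f' x) g (I - I')"
  using has_rs_integral_add[OF assms(1) has_rs_integral_cmult[OF assms(2), of "-1"]] by simp

lemma has_rs_integral_const:
  assumes "a \<le> b"
  shows "has_rs_integral a b (\<lambda>_. c) g (c * (g b - g a))"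
proof -
  have "rs_sum (\<lambda>_. c) g p = c * (g b - g a)" if "p tagged_division_of {a..b}" for p
    unfolding rs_sum_def sum_increments[OF assms that, symmetric]
    by (simp add: sum_distrib_left case_prod_beta)
  then show ?thesis
    unfolding has_rs_integral_iff_rs_sum by (auto intro!: exI[of _ 1])
qed

lemma norm_rs_integral_diff_le:
  assumes "continuous_on {a..b} f" "continuous_on {a..b} f'"
    and V: "variation_majorant V g a b" and "a \<le> b"
    and le: "\<And>x. x \<in> {a..b} \<Longrightarrow> norm (f x - f' x) \<le> B"
  shows "norm (rs_integral a b f g - rs_integral a b f' g) \<le> B * (V b - V a)"
  by (rule norm_has_rs_integral_le[OF has_rs_integral_diff[OF
        has_rs_integral_rs_integral[OF assms(1) V \<open>a \<le> b\<close>] has_rs_integral_rs_integral[OF assms(2) V \<open>a \<le> b\<close>]]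
        V \<open>a \<le> b\<close>]) (rule le)

section \<open>Interchanging the integrals on a rectangle\<close>

lemma uniform_modulus_rectangle:
  fixes k :: "real \<Rightarrow> real \<Rightarrow> 'a::real_normed_vector"
  assumes "continuous_on ({c..d} \<times> {a..b}) (\<lambda>(\<xi>, \<theta>). k \<xi> \<theta>)" "e > 0"
  obtains \<delta> where "\<delta> > 0"
    "\<And>\<xi> x y. \<lbrakk>\<xi> \<in> {c..d}; x \<in> {a..b}; y \<in> {a..b}; \<bar>x - y\<bar> < 2 * \<delta>\<rbrakk> \<Longrightarrow> norm (k \<xi> x - k \<xi> y) \<le> e"
    "\<And>\<xi> \<xi>' x. \<lbrakk>\<xi> \<in> {c..d}; \<xi>' \<in> {c..d}; x \<in> {a..b}; \<bar>\<xi> - \<xi>'\<bar> < 2 * \<delta>\<rbrakk> \<Longrightarrow> norm (k \<xi> x - k \<xi>' x) \<le> e"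
proof -
  have "uniformly_continuous_on ({c..d} \<times> {a..b}) (\<lambda>(\<xi>, \<theta>). k \<xi> \<theta>)"
    using assms(1) by (simp add: compact_uniformly_continuous compact_Times)
  then obtain m where m: "m > 0"
      "\<And>s t. \<lbrakk>s \<in> {c..d} \<times> {a..b}; t \<in> {c..d} \<times> {a..b}; dist t s < m\<rbrakk> \<Longrightarrow>
        dist (case_prod k t) (case_prod k s) < e"
    unfolding uniformly_continuous_on_def using assms(2) by metis
  show thesis
  proof (rule that[of "m / 2"])
    fix \<xi> x y assume "\<xi> \<in> {c..d}" "x \<in> {a..b}" "y \<in> {a..b}" "\<bar>x - y\<bar> < 2 * (m / 2)"
    then show "norm (k \<xi> x - k \<xi> y) \<le> e"
      using m(2)[of "(\<xi>, y)" "(\<xi>, x)"] by (simp add: dist_Pair_Pair dist_norm)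
  next
    fix \<xi> \<xi>' x assume "\<xi> \<in> {c..d}" "\<xi>' \<in> {c..d}" "x \<in> {a..b}" "\<bar>\<xi> - \<xi>'\<bar> < 2 * (m / 2)"
    then show "norm (k \<xi> x - k \<xi>' x) \<le> e"
      using m(2)[of "(\<xi>', x)" "(\<xi>, x)"] by (simp add: dist_Pair_Pair dist_norm)
  qed (use m(1) in simp)
qed

lemma continuous_on_rectangle_sections:
  assumes "continuous_on (S \<times> T) (\<lambda>(\<xi>, \<theta>). k \<xi> \<theta>)"
  shows "\<xi> \<in> S \<Longrightarrow> continuous_on T (\<lambda>\<theta>. k \<xi> \<theta>)" and "\<theta> \<in> T \<Longrightarrow> continuous_on S (\<lambda>\<xi>. k \<xi> \<theta>)"
proof -
  show "continuous_on T (\<lambda>\<theta>. k \<xi> \<theta>)" if "\<xi> \<in> S"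
    using continuous_on_compose2[OF assms continuous_on_Pair[OF continuous_on_const[of T \<xi>] continuous_on_id]] that
    by auto
  show "continuous_on S (\<lambda>\<xi>. k \<xi> \<theta>)" if "\<theta> \<in> T"
    using continuous_on_compose2[OF assms continuous_on_Pair[OF continuous_on_id continuous_on_const[of S \<theta>]]] that
    by auto
qed

lemma continuous_on_integral_rectangle:
  fixes k :: "real \<Rightarrow> real \<Rightarrow> 'a::banach"
  assumes "continuous_on ({c..d} \<times> {a..b}) (\<lambda>(\<xi>, \<theta>). k \<xi> \<theta>)"
  shows "continuous_on {a..b} (\<lambda>\<theta>. integral {c..d} (\<lambda>\<xi>. k \<xi> \<theta>))"
proof -
  have "continuous_on ({a..b} \<times> {c..d}) (\<lambda>z. (\<lambda>(\<xi>, \<theta>). k \<xi> \<theta>) (snd z, fst z))"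
    by (rule continuous_on_compose2[OF assms]) (auto intro!: continuous_intros)
  then have "continuous_on ({a..b} \<times> cbox c d) (\<lambda>(\<theta>, \<xi>). k \<xi> \<theta>)"
    by (simp add: case_prod_beta)
  from integral_continuous_on_param[OF this] show ?thesis
    by simp
qed

lemma continuous_on_rs_integral_rectangle:
  fixes k :: "real \<Rightarrow> real \<Rightarrow> complex"
  assumes k: "continuous_on ({c..d} \<times> {a..b}) (\<lambda>(\<xi>, \<theta>). k \<xi> \<theta>)"
    and V: "variation_majorant V g a b" and "a \<le> b"
  shows "continuous_on {c..d} (\<lambda>\<xi>. rs_integral a b (k \<xi>) g)"
  unfolding continuous_on_iff
proof (intro ballI allI impI)
  fix \<xi> and e :: real assume \<xi>: "\<xi> \<in> {c..d}" and "e > 0"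
  have M: "V b - V a \<ge> 0"
    using variation_majorant_mono[OF V, of a b] \<open>a \<le> b\<close> by simp
  define e' where "e' = e / (V b - V a + 1)"
  have "e' > 0"
    using \<open>e > 0\<close> M unfolding e'_def by simp
  then obtain \<delta> where \<delta>: "\<delta> > 0"
      "\<And>\<xi> \<xi>' x. \<lbrakk>\<xi> \<in> {c..d}; \<xi>' \<in> {c..d}; x \<in> {a..b}; \<bar>\<xi> - \<xi>'\<bar> < 2 * \<delta>\<rbrakk> \<Longrightarrow> norm (k \<xi> x - k \<xi>' x) \<le> e'"
    by (rule uniform_modulus_rectangle[OF k]) blast
  have "dist (rs_integral a b (k \<xi>') g) (rs_integral a b (k \<xi>) g) < e"
    if \<xi>': "\<xi>' \<in> {c..d}" "dist \<xi>' \<xi> < 2 * \<delta>" for \<xi>'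
  proof -
    have "norm (rs_integral a b (k \<xi>') g - rs_integral a b (k \<xi>) g) \<le> e' * (V b - V a)"
      using \<delta>(2)[of \<xi>' \<xi>] \<xi> \<xi>' continuous_on_rectangle_sections(1)[OF k] V \<open>a \<le> b\<close>
      by (intro norm_rs_integral_diff_le) (auto simp: dist_real_def)
    also have "\<dots> < e' * (V b - V a + 1)"
      using \<open>e' > 0\<close> by simp
    also have "\<dots> = e"
      using M unfolding e'_def by simp
    finally show ?thesis
      by (simp add: dist_norm)
  qed
  then show "\<exists>\<delta>>0. \<forall>\<xi>'\<in>{c..d}. dist \<xi>' \<xi> < \<delta> \<longrightarrow>
      dist (rs_integral a b (k \<xi>') g) (rs_integral a b (k \<xi>) g) < e"
    using \<delta>(1) by (intro exI[of _ "2 * \<delta>"]) auto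
qed

text \<open>
  For a Riemann--Stieltjes sum in place of the integral the interchange is that of a finite sum
  and an integral. All integrands involved share the modulus of continuity of \<open>k\<close>, so one
  division serves both sides with an error proportional to \<open>e\<close>.
\<close>

lemma integral_rs_integral_swap:
  fixes k :: "real \<Rightarrow> real \<Rightarrow> complex"
  assumes k: "continuous_on ({c..d} \<times> {a..b}) (\<lambda>(\<xi>, \<theta>). k \<xi> \<theta>)"
    and V: "variation_majorant V g a b" and "a \<le> b" "c \<le> d"
  shows "integral {c..d} (\<lambda>\<xi>. rs_integral a b (k \<xi>) g) =
    rs_integral a b (\<lambda>\<theta>. integral {c..d} (\<lambda>\<xi>. k \<xi> \<theta>)) g"
proof (rule eq_if_norm_diff_le_mult)
  fix e :: real assume "e > 0"
  define M where "M = V b - V a"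
  note sections = continuous_on_rectangle_sections[OF k]
  obtain \<delta> where \<delta>: "\<delta> > 0"
      "\<And>\<xi> x y. \<lbrakk>\<xi> \<in> {c..d}; x \<in> {a..b}; y \<in> {a..b}; \<bar>x - y\<bar> < 2 * \<delta>\<rbrakk> \<Longrightarrow> norm (k \<xi> x - k \<xi> y) \<le> e"
    by (rule uniform_modulus_rectangle[OF k \<open>e > 0\<close>]) blast
  obtain p where p: "p tagged_division_of {a..b}" "mesh_below \<delta> p"
    by (rule fine_tagged_division_exists[OF \<delta>(1)])
  have fin: "finite p"
    using p(1) by auto
  have tag: "x \<in> {a..b}" if "(x, K) \<in> p" for x K
    using tag_in_interval[OF p(1) that] .
  have cont_sum: "continuous_on {c..d} (\<lambda>\<xi>. rs_sum (k \<xi>) g p)"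
    unfolding rs_sum_def case_prod_beta
    by (intro continuous_intros sections) (metis prod.collapse tag)
  have cont_rs: "continuous_on {c..d} (\<lambda>\<xi>. rs_integral a b (k \<xi>) g)"
    by (rule continuous_on_rs_integral_rectangle[OF k V \<open>a \<le> b\<close>])
  have "norm (integral {c..d} (\<lambda>\<xi>. rs_sum (k \<xi>) g p - rs_integral a b (k \<xi>) g)) \<le> e * M * (d - c)"
  proof (rule integral_bound[OF \<open>c \<le> d\<close>])
    show "continuous_on {c..d} (\<lambda>\<xi>. rs_sum (k \<xi>) g p - rs_integral a b (k \<xi>) g)"
      by (intro continuous_intros cont_sum cont_rs)
    show "norm (rs_sum (k \<xi>) g p - rs_integral a b (k \<xi>) g) \<le> e * M" if "\<xi> \<in> {c..d}" for \<xi>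
      unfolding M_def
      using norm_rs_sum_minus_integral_le[OF has_rs_integral_rs_integral[OF sections(1)[OF that] V \<open>a \<le> b\<close>]
          V \<open>a \<le> b\<close> p \<delta>(1) \<delta>(2)[OF that]] .
  qed
  then have near1: "norm (integral {c..d} (\<lambda>\<xi>. rs_sum (k \<xi>) g p) - integral {c..d} (\<lambda>\<xi>. rs_integral a b (k \<xi>) g))
      \<le> e * M * (d - c)"
    by (simp add: integral_diff integrable_continuous_real cont_sum cont_rs)
  have sum_eq: "integral {c..d} (\<lambda>\<xi>. rs_sum (k \<xi>) g p) = rs_sum (\<lambda>\<theta>. integral {c..d} (\<lambda>\<xi>. k \<xi> \<theta>)) g p"
    unfolding rs_sum_def case_prod_beta
  proof (subst integral_sum[OF fin])
    show "(\<lambda>\<xi>. k \<xi> (fst s) * (g (Sup (snd s)) - g (Inf (snd s)))) integrable_on {c..d}" if "s \<in> p" for s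
      using tag[of "fst s" "snd s"] that
      by (intro integrable_continuous_real continuous_intros sections) auto
  qed simp
  have "norm (rs_sum (\<lambda>\<theta>. integral {c..d} (\<lambda>\<xi>. k \<xi> \<theta>)) g p -
      rs_integral a b (\<lambda>\<theta>. integral {c..d} (\<lambda>\<xi>. k \<xi> \<theta>)) g) \<le> e * (d - c) * M"
    unfolding M_def
  proof (rule norm_rs_sum_minus_integral_le[OF has_rs_integral_rs_integral V \<open>a \<le> b\<close> p \<delta>(1)])
    show "continuous_on {a..b} (\<lambda>\<theta>. integral {c..d} (\<lambda>\<xi>. k \<xi> \<theta>))"
      by (rule continuous_on_integral_rectangle[OF k])
    fix x y assume xy: "x \<in> {a..b}" "y \<in> {a..b}" "\<bar>x - y\<bar> < 2 * \<delta>"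
    have "norm (integral {c..d} (\<lambda>\<xi>. k \<xi> x - k \<xi> y)) \<le> e * (d - c)"
      using xy \<delta>(2) by (intro integral_bound[OF \<open>c \<le> d\<close>] continuous_intros sections) auto
    then show "norm (integral {c..d} (\<lambda>\<xi>. k \<xi> x) - integral {c..d} (\<lambda>\<xi>. k \<xi> y)) \<le> e * (d - c)"
      using xy by (simp add: integral_diff integrable_continuous_real sections)
  qed (use V \<open>a \<le> b\<close> in auto)
  then show "norm (integral {c..d} (\<lambda>\<xi>. rs_integral a b (k \<xi>) g) -
      rs_integral a b (\<lambda>\<theta>. integral {c..d} (\<lambda>\<xi>. k \<xi> \<theta>)) g) \<le> e * (2 * M * (d - c))"
    using near1 norm_triangle_le[of
        "integral {c..d} (\<lambda>\<xi>. rs_integral a b (k \<xi>) g) - integral {c..d} (\<lambda>\<xi>. rs_sum (k \<xi>) g p)"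
        "integral {c..d} (\<lambda>\<xi>. rs_sum (k \<xi>) g p) - rs_integral a b (\<lambda>\<theta>. integral {c..d} (\<lambda>\<xi>. k \<xi> \<theta>)) g"
        "e * (2 * M * (d - c))"]
    unfolding sum_eq by (simp add: norm_minus_commute algebra_simps)
qed

section \<open>Interchanging the integrals on a triangle\<close>

text \<open>
  The integrator splits as \<open>h = (h + V) - V\<close> into monotone functions, and the second mean value
  theorem provides the integrability of a product with a monotone factor.
\<close>

lemma integrable_continuous_mult_variation_real:
  fixes f h :: "real \<Rightarrow> real"
  assumes f: "continuous_on {a..b} f" and V: "variation_majorant V h a b" and "a \<le> b"
  shows "(\<lambda>x. f x * h x) integrable_on {a..b}"
proof -
  have mono_mult: "(\<lambda>x. m x * f x) integrable_on {a..b}"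
    if "\<And>x y. \<lbrakk>a \<le> x; x \<le> y; y \<le> b\<rbrakk> \<Longrightarrow> m x \<le> m y" for m :: "real \<Rightarrow> real"
    by (rule second_mean_value_theorem_full[OF integrable_continuous_real[OF f] \<open>a \<le> b\<close> that])
      (auto simp: integrable_on_def)
  have "(\<lambda>x. (h x + V x) * f x) integrable_on {a..b}"
  proof (rule mono_mult)
    fix x y assume "a \<le> x" "x \<le> y" "y \<le> b"
    from variation_majorantD[OF V this] show "h x + V x \<le> h y + V y"
      by simp
  qed
  moreover have "(\<lambda>x. V x * f x) integrable_on {a..b}"
    by (rule mono_mult) (rule variation_majorant_mono[OF V])
  ultimately have "(\<lambda>x. (h x + V x) * f x - V x * f x) integrable_on {a..b}"
    by (rule integrable_diff)
  then show ?thesis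
    by (simp add: algebra_simps)
qed

lemma integrable_continuous_mult_variation:
  fixes f g :: "real \<Rightarrow> complex"
  assumes f: "continuous_on {a..b} f" and V: "variation_majorant V g a b" and "a \<le> b"
  shows "(\<lambda>x. f x * g x) integrable_on {a..b}"
proof -
  have g_Re: "variation_majorant V (\<lambda>x. Re (g x)) a b" and g_Im: "variation_majorant V (\<lambda>x. Im (g x)) a b"
    using V abs_Re_le_cmod abs_Im_le_cmod unfolding variation_majorant_def
    by (metis minus_complex.sel order_trans real_norm_def)+
  have f_Re: "continuous_on {a..b} (\<lambda>x. Re (f x))" and f_Im: "continuous_on {a..b} (\<lambda>x. Im (f x))"
    using f by (auto intro: continuous_intros)
  have of_real: "(\<lambda>x. complex_of_real (m x)) integrable_on {a..b}"
    if "m integrable_on {a..b}" for m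
    using integrable_linear[OF that bounded_linear_of_real] by (simp add: o_def)
  have "(\<lambda>x. complex_of_real (Re (f x) * Re (g x) - Im (f x) * Im (g x)) +
      \<i> * complex_of_real (Re (f x) * Im (g x) + Im (f x) * Re (g x))) integrable_on {a..b}"
    by (intro integrable_add integrable_diff integrable_on_mult_right of_real
        integrable_continuous_mult_variation_real[OF f_Re g_Re \<open>a \<le> b\<close>]
        integrable_continuous_mult_variation_real[OF f_Im g_Im \<open>a \<le> b\<close>]
        integrable_continuous_mult_variation_real[OF f_Re g_Im \<open>a \<le> b\<close>]
        integrable_continuous_mult_variation_real[OF f_Im g_Re \<open>a \<le> b\<close>])
  also have "(\<lambda>x. complex_of_real (Re (f x) * Re (g x) - Im (f x) * Im (g x)) +
      \<i> * complex_of_real (Re (f x) * Im (g x) + Im (f x) * Re (g x))) = (\<lambda>x. f x * g x)"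
    by (simp add: fun_eq_iff complex_eq_iff)
  finally show ?thesis .
qed

text \<open>
  This is integration by parts: \<open>\<theta> \<mapsto> \<integral>\<^bsub>\<theta>\<^esub>\<^bsup>b\<^esup> w\<close> has derivative \<open>-w\<close> and vanishes
  at \<open>b\<close>, while \<open>g - g a\<close> vanishes at \<open>a\<close>, so there are no boundary terms. It is also the
  interchange of the integrals over the triangle \<open>a \<le> \<theta> \<le> \<xi> \<le> b\<close> for an integrand \<open>w \<xi>\<close> that does
  not depend on \<open>\<theta>\<close>.
\<close>

lemma integral_tail_has_rs_integral:
  fixes w :: "real \<Rightarrow> complex"
  assumes w: "continuous_on {a..b} w" and V: "variation_majorant V g a b" and "a \<le> b"
  shows "has_rs_integral a b (\<lambda>\<theta>. integral {\<theta>..b} w) g (integral {a..b} (\<lambda>x. w x * (g x - g a)))"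
proof -
  define W where "W \<theta> = integral {\<theta>..b} w" for \<theta>
  define J where "J = integral {a..b} (\<lambda>x. w x * (g x - g a))"
  define M where "M = V b - V a"
  have "M \<ge> 0"
    using variation_majorant_mono[OF V, of a b] \<open>a \<le> b\<close> unfolding M_def by simp
  have "bounded (w ` {a..b})"
    by (rule compact_imp_bounded[OF compact_continuous_image[OF w compact_Icc]])
  then obtain B where B: "\<And>x. x \<in> {a..b} \<Longrightarrow> norm (w x) \<le> B"
    unfolding bounded_iff by blast
  then have "B \<ge> 0"
    using \<open>a \<le> b\<close> by (meson atLeastAtMost_iff norm_ge_zero order_refl order_trans)
  have w_int: "w integrable_on {c..d}" if "a \<le> c" "d \<le> b" for c d
    using that by (intro integrable_continuous_real continuous_on_subset[OF w]) auto
  have W_diff: "W c - W d = integral {c..d} w" if "a \<le> c" "c \<le> d" "d \<le> b" for c d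
    using Henstock_Kurzweil_Integration.integral_combine[of c d b w] w_int[of c b] that unfolding W_def by (auto simp: algebra_simps)
  have int_mult: "(\<lambda>x. w x * g x) integrable_on {a..b}"
    by (rule integrable_continuous_mult_variation[OF w V \<open>a \<le> b\<close>])
  have int_J: "(\<lambda>x. w x * (g x - g a)) integrable_on {a..b}"
    using integrable_diff[OF int_mult integrable_on_mult_left[OF w_int[of a b], of "g a"]]
    by (simp add: algebra_simps)
  \<comment> \<open>On one interval of a division, the Riemann--Stieltjes term and the integral differ, up to the
    increment of \<open>W * (g - g a)\<close>, by a quantity of second order. Those increments telescope to \<open>0\<close>.\<close>
  have local: "norm (W x * (g d - g c) - integral {c..d} (\<lambda>s. w s * (g s - g a))
      - (W d * (g d - g a) - W c * (g c - g a))) \<le> 2 * B * (d - c) * (V d - V c)"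
    if K: "a \<le> c" "c \<le> x" "x \<le> d" "d \<le> b" for c d x
  proof -
    have sub: "{c..d} \<subseteq> {a..b}"
      using K by auto
    have int1: "(\<lambda>s. w s * g s) integrable_on {c..d}" and int2: "(\<lambda>s. w s * (g s - g a)) integrable_on {c..d}"
      using integrable_subinterval_real[OF _ sub] int_mult int_J by blast+
    have int3: "(\<lambda>s. w s * (g d - g a)) integrable_on {c..d}"
      using K by (intro integrable_on_mult_left w_int) auto
    have int4: "(\<lambda>s. w s * (g d - g s)) integrable_on {c..d}"
      using integrable_diff[OF int3 int2] by (simp add: algebra_simps)
    have "integral {c..d} (\<lambda>s. w s * (g d - g s)) =
        integral {c..d} (\<lambda>s. w s * (g d - g a) - w s * (g s - g a))"
      by (simp add: algebra_simps)
    also have "\<dots> = (W c - W d) * (g d - g a) - integral {c..d} (\<lambda>s. w s * (g s - g a))"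
      using K by (simp add: integral_diff[OF int3 int2] W_diff)
    finally have split: "W x * (g d - g c) - integral {c..d} (\<lambda>s. w s * (g s - g a))
        - (W d * (g d - g a) - W c * (g c - g a)) =
        (W x - W c) * (g d - g c) + integral {c..d} (\<lambda>s. w s * (g d - g s))"
      by (simp add: algebra_simps)
    have "norm (W c - W x) \<le> B * (x - c)"
      unfolding W_diff[OF K(1,2) order_trans[OF K(3,4)]]
      using K B by (intro integral_bound continuous_on_subset[OF w]) auto
    also have "\<dots> \<le> B * (d - c)"
      using K \<open>B \<ge> 0\<close> by (intro mult_left_mono) auto
    finally have "norm (W x - W c) \<le> B * (d - c)"
      by (simp add: norm_minus_commute)
    moreover have "norm (g d - g c) \<le> V d - V c"
      using K by (intro variation_majorantD[OF V]) auto
    ultimately have b1: "norm ((W x - W c) * (g d - g c)) \<le> B * (d - c) * (V d - V c)"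
      unfolding norm_mult by (intro mult_mono') auto
    have "norm (integral {c..d} (\<lambda>s. w s * (g d - g s))) \<le> integral {c..d} (\<lambda>s. B * (V d - V c))"
    proof (rule integral_norm_bound_integral[OF int4])
      fix s assume s: "s \<in> {c..d}"
      have "norm (g d - g s) \<le> V d - V s"
        using K s by (intro variation_majorantD[OF V]) auto
      also have "\<dots> \<le> V d - V c"
        using K s variation_majorant_mono[OF V, of c s] by simp
      finally show "norm (w s * (g d - g s)) \<le> B * (V d - V c)"
        unfolding norm_mult using B[of s] s K by (intro mult_mono') auto
    qed (rule integrable_continuous_real[OF continuous_on_const])
    then have "norm (integral {c..d} (\<lambda>s. w s * (g d - g s))) \<le> B * (d - c) * (V d - V c)"
      using K by (simp add: algebra_simps)
    with b1 show ?thesis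
      unfolding split by (intro order_trans[OF norm_triangle_ineq]) (simp add: algebra_simps)
  qed
  have near: "norm (rs_sum W g p - J) \<le> 2 * B * \<delta> * M"
    if p: "p tagged_division_of {a..b}" "mesh_below \<delta> p" for p \<delta>
  proof -
    have "J = (\<Sum>(x, K)\<in>p. integral K (\<lambda>s. w s * (g s - g a)))"
      unfolding J_def
      using integral_combine_tagged_division_topdown[of "\<lambda>s. w s * (g s - g a)" a b p] int_J p(1) by simp
    moreover have "(\<Sum>(x, K)\<in>p. W (Sup K) * (g (Sup K) - g a) - W (Inf K) * (g (Inf K) - g a)) = 0"
      using sum_increments[OF \<open>a \<le> b\<close> p(1), of "\<lambda>s. W s * (g s - g a)"] by (simp add: W_def)
    ultimately have expand: "rs_sum W g p - J = (\<Sum>(x, K)\<in>p. W x * (g (Sup K) - g (Inf K))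
        - integral K (\<lambda>s. w s * (g s - g a))
        - (W (Sup K) * (g (Sup K) - g a) - W (Inf K) * (g (Inf K) - g a)))"
      unfolding rs_sum_def by (simp add: case_prod_beta sum_subtractf)
    have "norm (rs_sum W g p - J) \<le> (\<Sum>(x, K)\<in>p. 2 * B * \<delta> * (V (Sup K) - V (Inf K)))"
      unfolding expand case_prod_beta
    proof (intro sum_norm_le)
      fix s assume "s \<in> p"
      then obtain x K where s: "s = (x, K)" and xK: "(x, K) \<in> p"
        by (metis surj_pair)
      obtain c d where K: "K = {c..d}" "c \<le> x" "x \<le> d" "a \<le> c" "d \<le> b" "Inf K = c" "Sup K = d"
        by (rule tagged_division_interval[OF p(1) xK])
      have "d - c \<le> \<delta>"
        using p(2) xK K unfolding mesh_below_def by fastforce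
      moreover have "V c \<le> V d"
        using K by (intro variation_majorant_mono[OF V]) auto
      ultimately have "2 * B * (d - c) * (V d - V c) \<le> 2 * B * \<delta> * (V d - V c)"
        using \<open>B \<ge> 0\<close> by (intro mult_right_mono mult_left_mono) auto
      with local[OF K(4,2,3,5)]
      show "norm (W (fst s) * (g (Sup (snd s)) - g (Inf (snd s)))
          - integral (snd s) (\<lambda>s. w s * (g s - g a))
          - (W (Sup (snd s)) * (g (Sup (snd s)) - g a) - W (Inf (snd s)) * (g (Inf (snd s)) - g a)))
          \<le> 2 * B * \<delta> * (V (Sup (snd s)) - V (Inf (snd s)))"
        unfolding s fst_conv snd_conv K(6,7) unfolding K(1) by (rule order_trans)
    qed
    also have "\<dots> = 2 * B * \<delta> * M"
      unfolding M_def
      by (simp add: sum_increments[OF \<open>a \<le> b\<close> p(1), symmetric] sum_distrib_left case_prod_beta)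
    finally show ?thesis .
  qed
  have "has_rs_integral a b W g J"
    unfolding has_rs_integral_iff_rs_sum
  proof (intro allI impI)
    fix e :: real assume "e > 0"
    have pos: "2 * B * M + 1 > 0"
      using \<open>B \<ge> 0\<close> \<open>M \<ge> 0\<close> by (simp add: add_nonneg_pos)
    define \<delta> where "\<delta> = e / (2 * B * M + 1)"
    have "\<delta> > 0"
      using \<open>e > 0\<close> pos unfolding \<delta>_def by simp
    have "2 * B * \<delta> * M < \<delta> * (2 * B * M + 1)"
      using \<open>\<delta> > 0\<close> by (simp add: algebra_simps)
    also have "\<dots> = e"
      using pos unfolding \<delta>_def by simp
    finally have "2 * B * \<delta> * M < e" .
    then have "\<forall>p. p tagged_division_of {a..b} \<and> mesh_below \<delta> p \<longrightarrow> norm (rs_sum W g p - J) < e"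
      using near le_less_trans by blast
    then show "\<exists>\<delta>>0. \<forall>p. p tagged_division_of {a..b} \<and> mesh_below \<delta> p \<longrightarrow> norm (rs_sum W g p - J) < e"
      using \<open>\<delta> > 0\<close> by blast
  qed
  then show ?thesis
    unfolding W_def J_def .
qed

lemma has_rs_integral_vanishing_tail:
  assumes f: "continuous_on {a..b} f" and V: "variation_majorant V g a b"
    and "a \<le> c" "c \<le> b" and zero: "\<And>x. x \<in> {c..b} \<Longrightarrow> f x = 0"
  shows "has_rs_integral a c f g (rs_integral a b f g)"
proof -
  have "has_rs_integral c b f g 0"
    using has_rs_integral_const[OF \<open>c \<le> b\<close>, of 0 g] has_rs_integral_cong[of c b f "\<lambda>_. 0" g 0] zero by simp
  moreover have "continuous_on {a..c} f" "variation_majorant V g a c"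
    using \<open>c \<le> b\<close> continuous_on_subset[OF f, of "{a..c}"] variation_majorant_subinterval[OF V, of a c] by auto
  from has_rs_integral_rs_integral[OF this \<open>a \<le> c\<close>]
  have "has_rs_integral a c f g (rs_integral a c f g)" .
  moreover have "has_rs_integral a b f g (rs_integral a b f g)"
    using f V \<open>a \<le> c\<close> \<open>c \<le> b\<close> by (intro has_rs_integral_rs_integral) auto
  ultimately show ?thesis
    using has_rs_integral_combine[OF \<open>a \<le> c\<close> \<open>c \<le> b\<close>] by fastforce
qed

text \<open>
  The kernel \<open>h\<close>, cut off outside the triangle, jumps along the diagonal, where \<open>g\<close> may jump
  too. Subtracting its value \<open>w \<xi> = h \<xi> \<xi>\<close> on the diagonal leaves \<open>h \<xi> (min \<theta> \<xi>) - w \<xi>\<close>, which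
  vanishes for \<open>\<theta> \<ge> \<xi>\<close> and is continuous on the whole square, so that the interchange on a
  rectangle applies. The subtracted part does not depend on \<open>\<theta>\<close> and is integrated by parts.
\<close>

lemma rs_integral_triangle_swap:
  fixes h :: "real \<Rightarrow> real \<Rightarrow> complex"
  assumes h: "continuous_on {(\<xi>, \<theta>). a \<le> \<theta> \<and> \<theta> \<le> \<xi> \<and> \<xi> \<le> b} (\<lambda>(\<xi>, \<theta>). h \<xi> \<theta>)"
    and V: "variation_majorant V g a b" and "a \<le> b"
  shows "(\<lambda>\<xi>. rs_integral a \<xi> (h \<xi>) g) integrable_on {a..b}"
    and "has_rs_integral a b (\<lambda>\<theta>. integral {\<theta>..b} (\<lambda>\<xi>. h \<xi> \<theta>)) g
      (integral {a..b} (\<lambda>\<xi>. rs_integral a \<xi> (h \<xi>) g))"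
proof -
  define w where "w \<xi> = h \<xi> \<xi>" for \<xi>
  define k where "k \<xi> \<theta> = h \<xi> (min \<theta> \<xi>) - w \<xi>" for \<xi> \<theta>
  have w: "continuous_on {a..b} w"
  proof -
    have "continuous_on {a..b} (\<lambda>\<xi>. (\<lambda>(\<xi>, \<theta>). h \<xi> \<theta>) (\<xi>, \<xi>))"
      by (rule continuous_on_compose2[OF h]) (auto intro!: continuous_intros)
    then show ?thesis
      by (simp add: w_def)
  qed
  have k: "continuous_on ({a..b} \<times> {a..b}) (\<lambda>(\<xi>, \<theta>). k \<xi> \<theta>)"
  proof -
    have "continuous_on ({a..b} \<times> {a..b}) (\<lambda>z. (\<lambda>(\<xi>, \<theta>). h \<xi> \<theta>) (fst z, min (snd z) (fst z)))"
      by (rule continuous_on_compose2[OF h]) (auto intro!: continuous_intros)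
    moreover have "continuous_on ({a..b} \<times> {a..b}) (\<lambda>z. w (fst z))"
      by (rule continuous_on_compose2[OF w]) (auto intro!: continuous_intros)
    ultimately have "continuous_on ({a..b} \<times> {a..b}) (\<lambda>z. h (fst z) (min (snd z) (fst z)) - w (fst z))"
      by (auto intro!: continuous_intros)
    then show ?thesis
      by (simp add: k_def case_prod_beta)
  qed
  note sections = continuous_on_rectangle_sections[OF k]
  have inner: "rs_integral a \<xi> (h \<xi>) g = rs_integral a b (k \<xi>) g + w \<xi> * (g \<xi> - g a)"
    if \<xi>: "\<xi> \<in> {a..b}" for \<xi>
  proof (rule rs_integral_unique)
    have "has_rs_integral a \<xi> (k \<xi>) g (rs_integral a b (k \<xi>) g)"
      by (rule has_rs_integral_vanishing_tail[OF sections(1)[OF \<xi>] V]) (use \<xi> in \<open>auto simp: k_def w_def min_def\<close>)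
    then have "has_rs_integral a \<xi> (\<lambda>\<theta>. k \<xi> \<theta> + w \<xi>) g (rs_integral a b (k \<xi>) g + w \<xi> * (g \<xi> - g a))"
      using \<xi> by (intro has_rs_integral_add has_rs_integral_const) auto
    then show "has_rs_integral a \<xi> (h \<xi>) g (rs_integral a b (k \<xi>) g + w \<xi> * (g \<xi> - g a))"
      using has_rs_integral_cong[of a \<xi> "\<lambda>\<theta>. k \<xi> \<theta> + w \<xi>" "h \<xi>" g] by (simp add: k_def min_def)
  qed
  have tail: "integral {\<theta>..b} (\<lambda>\<xi>. h \<xi> \<theta>) = integral {a..b} (\<lambda>\<xi>. k \<xi> \<theta>) + integral {\<theta>..b} w"
    if \<theta>: "\<theta> \<in> {a..b}" for \<theta>
  proof -
    have k_int: "(\<lambda>\<xi>. k \<xi> \<theta>) integrable_on {a..b}"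
      by (rule integrable_continuous_real[OF sections(2)[OF \<theta>]])
    have "integral {a..\<theta>} (\<lambda>\<xi>. k \<xi> \<theta>) = integral {a..\<theta>} (\<lambda>\<xi>. 0)"
      by (rule integral_cong) (auto simp: k_def w_def min_def)
    then have "integral {a..b} (\<lambda>\<xi>. k \<xi> \<theta>) = integral {\<theta>..b} (\<lambda>\<xi>. k \<xi> \<theta>)"
      using Henstock_Kurzweil_Integration.integral_combine[of a \<theta> b, OF _ _ k_int] \<theta> by simp
    moreover have "integral {\<theta>..b} (\<lambda>\<xi>. k \<xi> \<theta> + w \<xi>) = integral {\<theta>..b} (\<lambda>\<xi>. k \<xi> \<theta>) + integral {\<theta>..b} w"
      using \<theta> by (intro integral_add integrable_subinterval_real[OF k_int]
          integrable_subinterval_real[OF integrable_continuous_real[OF w]]) auto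
    moreover have "integral {\<theta>..b} (\<lambda>\<xi>. k \<xi> \<theta> + w \<xi>) = integral {\<theta>..b} (\<lambda>\<xi>. h \<xi> \<theta>)"
      by (rule integral_cong) (auto simp: k_def min_def)
    ultimately show ?thesis
      by simp
  qed
  have rs_w: "has_rs_integral a b (\<lambda>\<theta>. integral {\<theta>..b} w) g (integral {a..b} (\<lambda>x. w x * (g x - g a)))"
    by (rule integral_tail_has_rs_integral[OF w V \<open>a \<le> b\<close>])
  have rs_k: "has_rs_integral a b (\<lambda>\<theta>. integral {a..b} (\<lambda>\<xi>. k \<xi> \<theta>)) g
      (rs_integral a b (\<lambda>\<theta>. integral {a..b} (\<lambda>\<xi>. k \<xi> \<theta>)) g)"
    by (rule has_rs_integral_rs_integral[OF continuous_on_integral_rectangle[OF k] V \<open>a \<le> b\<close>])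
  have int_w: "(\<lambda>x. w x * (g x - g a)) integrable_on {a..b}"
    using integrable_diff[OF integrable_continuous_mult_variation[OF w V \<open>a \<le> b\<close>]
        integrable_on_mult_left[OF integrable_continuous_real[OF w], of "g a"]] by (simp add: algebra_simps)
  have int_k: "(\<lambda>\<xi>. rs_integral a b (k \<xi>) g) integrable_on {a..b}"
    by (intro integrable_continuous_real continuous_on_rs_integral_rectangle[OF k V \<open>a \<le> b\<close>])
  have "(\<lambda>\<xi>. rs_integral a b (k \<xi>) g + w \<xi> * (g \<xi> - g a)) integrable_on {a..b}"
    by (rule integrable_add[OF int_k int_w])
  then show "(\<lambda>\<xi>. rs_integral a \<xi> (h \<xi>) g) integrable_on {a..b}"
    by (rule integrable_eq) (simp add: inner)
  have "integral {a..b} (\<lambda>\<xi>. rs_integral a \<xi> (h \<xi>) g) =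
      integral {a..b} (\<lambda>\<xi>. rs_integral a b (k \<xi>) g + w \<xi> * (g \<xi> - g a))"
    by (rule integral_cong[OF inner])
  also have "\<dots> = rs_integral a b (\<lambda>\<theta>. integral {a..b} (\<lambda>\<xi>. k \<xi> \<theta>)) g
      + integral {a..b} (\<lambda>x. w x * (g x - g a))"
    by (simp add: integral_add[OF int_k int_w] integral_rs_integral_swap[OF k V \<open>a \<le> b\<close> \<open>a \<le> b\<close>])
  finally have "has_rs_integral a b (\<lambda>\<theta>. integral {a..b} (\<lambda>\<xi>. k \<xi> \<theta>) + integral {\<theta>..b} w) g
      (integral {a..b} (\<lambda>\<xi>. rs_integral a \<xi> (h \<xi>) g))"
    using has_rs_integral_add[OF rs_k rs_w] by simp
  then show "has_rs_integral a b (\<lambda>\<theta>. integral {\<theta>..b} (\<lambda>\<xi>. h \<xi> \<theta>)) g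
      (integral {a..b} (\<lambda>\<xi>. rs_integral a \<xi> (h \<xi>) g))"
    by (rule iffD1[OF has_rs_integral_cong, rotated]) (rule tail[symmetric])
qed

lemma rs_integral_cmult:
  assumes "continuous_on {a..b} f" "variation_majorant V g a b" "a \<le> b"
  shows "rs_integral a b (\<lambda>x. c * f x) g = c * rs_integral a b f g"
  by (rule rs_integral_unique[OF has_rs_integral_cmult[OF has_rs_integral_rs_integral[OF assms]]])

section \<open>The derivative of the bilinear form\<close>

text \<open>
  After the interchange, and with \<open>s = t + \<xi>\<close>, the double integral is the Riemann--Stieltjes
  integral of \<open>G t \<theta> = \<integral>\<^bsub>t+\<theta>\<^esub>\<^bsup>t\<^esup> q s * p (s - \<theta>) ds\<close>. Here \<open>t\<close> occurs only in the limits of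
  integration, so \<open>G\<close> has the continuous \<open>t\<close>-derivative
  \<open>k t \<theta> = q t * p (t - \<theta>) - p t * q (t + \<theta>)\<close>. A second interchange, on the rectangle
  \<open>[\<alpha>, t] \<times> [-r, 0]\<close>, exhibits the double integral as a constant plus the integral of \<open>D\<close>.
\<close>

lemma sliding_double_integral_derivative:
  fixes p q g :: "real \<Rightarrow> complex"
  assumes "r > 0" "\<alpha> \<le> \<beta>" and V: "variation_majorant V g (-r) 0"
    and p: "continuous_on {\<alpha>..\<beta> + r} p" and q: "continuous_on {\<alpha> - r..\<beta>} q"
  defines "\<Psi> \<equiv> \<lambda>t \<xi>. rs_integral (-r) \<xi> (\<lambda>\<theta>. p (t + (\<xi> - \<theta>))) g * q (t + \<xi>)"
    and "D \<equiv> \<lambda>t. rs_integral (-r) 0 (\<lambda>\<theta>. p (t - \<theta>)) g * q t - p t * rs_integral (-r) 0 (\<lambda>\<theta>. q (t + \<theta>)) g"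
  shows "\<And>t. t \<in> {\<alpha>..\<beta>} \<Longrightarrow> \<Psi> t integrable_on {-r..0}"
    and "continuous_on {\<alpha>..\<beta>} D"
    and "\<And>t. t \<in> {\<alpha>..\<beta>} \<Longrightarrow>
      ((\<lambda>s. integral {-r..0} (\<Psi> s)) has_vector_derivative D t) (at t within {\<alpha>..\<beta>})"
proof -
  have r: "-r \<le> 0"
    using \<open>r > 0\<close> by simp
  define h where "h t \<xi> \<theta> = q (t + \<xi>) * p (t + (\<xi> - \<theta>))" for t \<xi> \<theta>
  define G where "G t \<theta> = integral {\<theta>..0} (\<lambda>\<xi>. h t \<xi> \<theta>)" for t \<theta>
  define k where "k s \<theta> = q s * p (s - \<theta>) - p s * q (s + \<theta>)" for s \<theta>
  have h_cont: "continuous_on {(\<xi>, \<theta>). -r \<le> \<theta> \<and> \<theta> \<le> \<xi> \<and> \<xi> \<le> 0} (\<lambda>(\<xi>, \<theta>). h t \<xi> \<theta>)"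
    if "t \<in> {\<alpha>..\<beta>}" for t
    unfolding h_def case_prod_beta using that
    by (intro continuous_intros continuous_on_compose2[OF p] continuous_on_compose2[OF q]) auto
  have \<Psi>_eq: "rs_integral (-r) \<xi> (h t \<xi>) g = \<Psi> t \<xi>" if t: "t \<in> {\<alpha>..\<beta>}" and \<xi>: "\<xi> \<in> {-r..0}" for t \<xi>
  proof -
    have "continuous_on {-r..\<xi>} (\<lambda>\<theta>. p (t + (\<xi> - \<theta>)))"
      using t \<xi> by (intro continuous_intros continuous_on_compose2[OF p]) auto
    moreover have "variation_majorant V g (-r) \<xi>"
      using \<xi> by (intro variation_majorant_subinterval[OF V]) auto
    ultimately show ?thesis
      using \<xi> rs_integral_cmult unfolding h_def \<Psi>_def by (simp add: mult.commute)
  qed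
  show int_\<Psi>: "\<Psi> t integrable_on {-r..0}" if "t \<in> {\<alpha>..\<beta>}" for t
    using rs_integral_triangle_swap(1)[OF h_cont[OF that] V r] by (rule integrable_eq) (use that \<Psi>_eq in auto)
  have G: "has_rs_integral (-r) 0 (G t) g (integral {-r..0} (\<Psi> t))" if "t \<in> {\<alpha>..\<beta>}" for t
  proof -
    have "integral {-r..0} (\<lambda>\<xi>. rs_integral (-r) \<xi> (h t \<xi>) g) = integral {-r..0} (\<Psi> t)"
      by (rule integral_cong) (rule \<Psi>_eq[OF that])
    then show ?thesis
      using rs_integral_triangle_swap(2)[OF h_cont[OF that] V r] unfolding G_def by simp
  qed
  have k: "continuous_on ({\<alpha>..\<beta>} \<times> {-r..0}) (\<lambda>(s, \<theta>). k s \<theta>)"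
    unfolding k_def case_prod_beta
    by (intro continuous_intros continuous_on_compose2[OF p] continuous_on_compose2[OF q])
      (use \<open>r > 0\<close> in auto)
  have D: "D t = rs_integral (-r) 0 (k t) g" if t: "t \<in> {\<alpha>..\<beta>}" for t
  proof -
    have p_t: "continuous_on {-r..0} (\<lambda>\<theta>. p (t - \<theta>))" and q_t: "continuous_on {-r..0} (\<lambda>\<theta>. q (t + \<theta>))"
      using t by (auto intro!: continuous_intros continuous_on_compose2[OF p] continuous_on_compose2[OF q])
    have "has_rs_integral (-r) 0 (k t) g (q t * rs_integral (-r) 0 (\<lambda>\<theta>. p (t - \<theta>)) g
        - p t * rs_integral (-r) 0 (\<lambda>\<theta>. q (t + \<theta>)) g)"
      unfolding k_def
      by (intro has_rs_integral_diff has_rs_integral_cmult has_rs_integral_rs_integral[OF _ V r] p_t q_t)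
    from rs_integral_unique[OF this] show ?thesis
      unfolding D_def by (simp add: mult.commute)
  qed
  have "continuous_on {\<alpha>..\<beta>} (\<lambda>t. rs_integral (-r) 0 (k t) g)"
    by (rule continuous_on_rs_integral_rectangle[OF k V r])
  then show D_cont: "continuous_on {\<alpha>..\<beta>} D"
    by (rule continuous_on_eq) (simp add: D)
  \<comment> \<open>Both sides are integrals of \<open>m s = q s * p (s - \<theta>)\<close>; the interval \<open>[t + \<theta>, t]\<close> arises from
    \<open>[\<alpha> + \<theta>, \<alpha>]\<close> by adding \<open>[\<alpha>, t]\<close> and removing \<open>[\<alpha> + \<theta>, t + \<theta>]\<close>.\<close>
  have G_increment: "G t \<theta> = G \<alpha> \<theta> + integral {\<alpha>..t} (\<lambda>s. k s \<theta>)"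
    if t: "t \<in> {\<alpha>..\<beta>}" and \<theta>: "\<theta> \<in> {-r..0}" for t \<theta>
  proof -
    define m where "m s = q s * p (s - \<theta>)" for s
    have "continuous_on {\<alpha> + \<theta>..t} m"
      unfolding m_def using t \<theta>
      by (intro continuous_intros continuous_on_compose2[OF p] continuous_on_compose2[OF q]) auto
    then have m_int: "m integrable_on {\<alpha> + \<theta>..t}"
      by (rule integrable_continuous_real)
    have G_m: "G s \<theta> = integral {s + \<theta>..s} m" for s
      using integral_shift_real_ivl[of "s + \<theta>" s s m] unfolding G_def h_def m_def by (simp add: algebra_simps)
    have int1: "m integrable_on {\<alpha>..t}"
      using \<theta> by (intro integrable_subinterval_real[OF m_int]) auto
    have "m integrable_on {\<alpha> + \<theta>..t + \<theta>}"
      using \<theta> by (intro integrable_subinterval_real[OF m_int]) auto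
    then have int2: "(\<lambda>s. m (s + \<theta>)) integrable_on {\<alpha>..t}"
      using integrable_shift_real_ivl[of m "\<alpha> + \<theta>" "t + \<theta>" \<theta>] by simp
    have "integral {\<alpha>..t} (\<lambda>s. k s \<theta>) = integral {\<alpha>..t} (\<lambda>s. m s - m (s + \<theta>))"
      unfolding k_def m_def by (simp add: mult.commute)
    also have "\<dots> = integral {\<alpha>..t} m - integral {\<alpha> + \<theta>..t + \<theta>} m"
      using integral_shift_real_ivl[of "\<alpha> + \<theta>" \<theta> "t + \<theta>" m] by (simp add: integral_diff[OF int1 int2])
    finally have "integral {\<alpha>..t} (\<lambda>s. k s \<theta>) = integral {\<alpha>..t} m - integral {\<alpha> + \<theta>..t + \<theta>} m" .
    moreover have "integral {\<alpha> + \<theta>..\<alpha>} m + integral {\<alpha>..t} m =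
        integral {\<alpha> + \<theta>..t + \<theta>} m + integral {t + \<theta>..t} m"
      using Henstock_Kurzweil_Integration.integral_combine[of "\<alpha> + \<theta>" \<alpha> t, OF _ _ m_int] Henstock_Kurzweil_Integration.integral_combine[of "\<alpha> + \<theta>" "t + \<theta>" t, OF _ _ m_int] t \<theta>
      by simp
    ultimately show ?thesis
      unfolding G_m by (simp add: add_diff_eq)
  qed
  have \<Psi>_increment: "integral {-r..0} (\<Psi> t) = integral {-r..0} (\<Psi> \<alpha>) + integral {\<alpha>..t} D"
    if t: "t \<in> {\<alpha>..\<beta>}" for t
  proof (rule has_rs_integral_unique[OF G[OF t]])
    have k_t: "continuous_on ({\<alpha>..t} \<times> {-r..0}) (\<lambda>(s, \<theta>). k s \<theta>)"
      using t by (intro continuous_on_subset[OF k]) auto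
    have "integral {\<alpha>..t} D = integral {\<alpha>..t} (\<lambda>s. rs_integral (-r) 0 (k s) g)"
      using t by (intro integral_cong D) auto
    also have "\<dots> = rs_integral (-r) 0 (\<lambda>\<theta>. integral {\<alpha>..t} (\<lambda>s. k s \<theta>)) g"
      using t by (intro integral_rs_integral_swap[OF k_t V r]) auto
    finally have "has_rs_integral (-r) 0 (\<lambda>\<theta>. G \<alpha> \<theta> + integral {\<alpha>..t} (\<lambda>s. k s \<theta>)) g
        (integral {-r..0} (\<Psi> \<alpha>) + integral {\<alpha>..t} D)"
      using \<open>\<alpha> \<le> \<beta>\<close>
      by (auto intro!: has_rs_integral_add G has_rs_integral_rs_integral[OF _ V r] continuous_on_integral_rectangle[OF k_t])
    then show "has_rs_integral (-r) 0 (G t) g (integral {-r..0} (\<Psi> \<alpha>) + integral {\<alpha>..t} D)"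
      by (rule iffD1[OF has_rs_integral_cong, rotated]) (rule G_increment[OF t, symmetric])
  qed
  show "((\<lambda>s. integral {-r..0} (\<Psi> s)) has_vector_derivative D t) (at t within {\<alpha>..\<beta>})"
    if t: "t \<in> {\<alpha>..\<beta>}" for t
  proof (rule has_vector_derivative_transform[OF t \<Psi>_increment])
    show "((\<lambda>s. integral {-r..0} (\<Psi> \<alpha>) + integral {\<alpha>..s} D) has_vector_derivative D t) (at t within {\<alpha>..\<beta>})"
      using integral_has_vector_derivative[OF D_cont t] by (auto intro: derivative_eq_intros)
  qed
qed

text \<open>
  Entrywise, the form is a finite sum of products \<open>v\<^sub>i * u\<^sub>i\<close>, to which the product rule applies, and
  of double integrals with \<open>p = v\<^sub>i\<close>, \<open>q = u\<^sub>j\<close> and \<open>g = \<eta>\<^sub>i\<^sub>j\<close>.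
\<close>

theorem corollary2p8:
  fixes r \<alpha> \<beta> :: real
    and \<eta> :: "real \<Rightarrow> complex^'n^'n"
    and u u' v v' :: "real \<Rightarrow> complex^'n"
  assumes "r > 0"
    and "\<alpha> \<le> \<beta>"
    and "bounded_variation_on \<eta> (-r) 0"
    and "continuous_on {\<alpha> - r..\<beta>} u"
    and "continuous_on {\<alpha>..\<beta> + r} v"
    and "\<forall>t\<in>{\<alpha>..\<beta>}. (u has_vector_derivative u' t) (at t within {\<alpha>..\<beta>})"
    and "continuous_on {\<alpha>..\<beta>} u'"
    and "\<forall>t\<in>{\<alpha>..\<beta>}. (v has_vector_derivative v' t) (at t within {\<alpha>..\<beta>})"
    and "continuous_on {\<alpha>..\<beta>} v'"
  shows "\<exists>D. continuous_on {\<alpha>..\<beta>} D \<and>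
    (\<forall>t\<in>{\<alpha>..\<beta>}.
      ((\<lambda>s. hale_form r \<eta> (future_segment v s) (history_segment u s))
        has_vector_derivative D t) (at t within {\<alpha>..\<beta>}) \<and>
      D t =
        (v' t + rs_integral_row (-r) 0 (\<lambda>\<theta>. v (t - \<theta>)) \<eta>) \<bullet>\<^sub>r\<^sub>c u t +
        v t \<bullet>\<^sub>r\<^sub>c (u' t - rs_integral_col (-r) 0 \<eta> (\<lambda>\<theta>. u (t + \<theta>))))"
proof -
  obtain V where V: "variation_majorant V \<eta> (-r) 0"
    using bounded_variation_imp_variation_majorant[OF assms(3)] by blast
  have V_entry: "variation_majorant V (\<lambda>\<theta>. \<eta> \<theta> $ i $ j) (-r) 0" for i j
    unfolding variation_majorant_def
  proof (intro allI impI)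
    fix x y assume xy: "-r \<le> x" "x \<le> y" "y \<le> 0"
    have "norm ((\<eta> y - \<eta> x) $ i $ j) \<le> norm (\<eta> y - \<eta> x)"
      by (rule order_trans[OF Finite_Cartesian_Product.norm_nth_le Finite_Cartesian_Product.norm_nth_le])
    then show "norm (\<eta> y $ i $ j - \<eta> x $ i $ j) \<le> V y - V x"
      using variation_majorantD[OF V xy] by simp
  qed
  define R where "R t i j = rs_integral (-r) 0 (\<lambda>\<theta>. v (t - \<theta>) $ i) (\<lambda>\<theta>. \<eta> \<theta> $ i $ j)" for t i j
  define C where "C t i j = rs_integral (-r) 0 (\<lambda>\<theta>. u (t + \<theta>) $ j) (\<lambda>\<theta>. \<eta> \<theta> $ i $ j)" for t i j
  define \<Psi> where "\<Psi> t i j \<xi> =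
      rs_integral (-r) \<xi> (\<lambda>\<theta>. v (t + (\<xi> - \<theta>)) $ i) (\<lambda>\<theta>. \<eta> \<theta> $ i $ j) * u (t + \<xi>) $ j" for t i j \<xi>
  define D where "D t = (\<Sum>i\<in>UNIV. v' t $ i * u t $ i + v t $ i * u' t $ i) +
      (\<Sum>i\<in>UNIV. \<Sum>j\<in>UNIV. R t i j * u t $ j - v t $ i * C t i j)" for t
  have v_i: "continuous_on {\<alpha>..\<beta> + r} (\<lambda>t. v t $ i)" for i
    by (intro continuous_intros assms)
  have u_j: "continuous_on {\<alpha> - r..\<beta>} (\<lambda>t. u t $ j)" for j
    by (intro continuous_intros assms)
  note entry = sliding_double_integral_derivative[OF assms(1,2) V_entry v_i u_j]
  have "continuous_on {\<alpha>..\<beta>} u" "continuous_on {\<alpha>..\<beta>} v"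
    using assms(1,4,5) by (auto elim: continuous_on_subset)
  then have D_cont: "continuous_on {\<alpha>..\<beta>} D"
    unfolding D_def R_def C_def using assms(7,9)
    by (intro continuous_intros entry(2)) auto
  have hale: "hale_form r \<eta> (future_segment v t) (history_segment u t) =
      (\<Sum>i\<in>UNIV. v t $ i * u t $ i) + (\<Sum>i\<in>UNIV. \<Sum>j\<in>UNIV. integral {-r..0} (\<Psi> t i j))"
    if t: "t \<in> {\<alpha>..\<beta>}" for t
  proof -
    have \<Psi>_int: "\<Psi> t i j integrable_on {-r..0}" for i j
      unfolding \<Psi>_def using entry(1)[OF t] .
    have "integral {-r..0} (\<lambda>\<xi>. rs_integral_row (-r) \<xi> (\<lambda>\<theta>. v (t + (\<xi> - \<theta>))) \<eta> \<bullet>\<^sub>r\<^sub>c u (t + \<xi>)) =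
        integral {-r..0} (\<lambda>\<xi>. \<Sum>j\<in>UNIV. \<Sum>i\<in>UNIV. \<Psi> t i j \<xi>)"
      unfolding rs_integral_row_def row_times_col_def \<Psi>_def by (simp add: sum_distrib_right)
    also have "\<dots> = (\<Sum>j\<in>UNIV. \<Sum>i\<in>UNIV. integral {-r..0} (\<Psi> t i j))"
      by (simp add: integral_sum integrable_sum \<Psi>_int)
    also have "\<dots> = (\<Sum>i\<in>UNIV. \<Sum>j\<in>UNIV. integral {-r..0} (\<Psi> t i j))"
      by (rule sum.swap)
    finally show ?thesis
      unfolding hale_form_def future_segment_def history_segment_def by (simp add: row_times_col_def)
  qed
  have "((\<lambda>s. hale_form r \<eta> (future_segment v s) (history_segment u s)) has_vector_derivative D t)
      (at t within {\<alpha>..\<beta>})" if t: "t \<in> {\<alpha>..\<beta>}" for t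
  proof (rule has_vector_derivative_transform[OF t hale])
    have "((\<lambda>s. v s $ i * u s $ i) has_vector_derivative v' t $ i * u t $ i + v t $ i * u' t $ i)
        (at t within {\<alpha>..\<beta>})" for i
    proof -
      have "((\<lambda>s. v s $ i) has_vector_derivative v' t $ i) (at t within {\<alpha>..\<beta>})"
          "((\<lambda>s. u s $ i) has_vector_derivative u' t $ i) (at t within {\<alpha>..\<beta>})"
        using assms(6,8) t by (auto intro: bounded_linear.has_vector_derivative[OF bounded_linear_vec_nth])
      from has_vector_derivative_mult[OF this] show ?thesis
        by (simp add: add.commute)
    qed
    moreover have "((\<lambda>s. integral {-r..0} (\<Psi> s i j)) has_vector_derivative R t i j * u t $ j - v t $ i * C t i j)
        (at t within {\<alpha>..\<beta>})" for i j
      unfolding \<Psi>_def R_def C_def using entry(3)[OF t] .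
    ultimately show "((\<lambda>s. (\<Sum>i\<in>UNIV. v s $ i * u s $ i) + (\<Sum>i\<in>UNIV. \<Sum>j\<in>UNIV. integral {-r..0} (\<Psi> s i j)))
        has_vector_derivative D t) (at t within {\<alpha>..\<beta>})"
      unfolding D_def by (intro has_vector_derivative_add has_vector_derivative_sum)
  qed
  moreover have "D t = (v' t + rs_integral_row (-r) 0 (\<lambda>\<theta>. v (t - \<theta>)) \<eta>) \<bullet>\<^sub>r\<^sub>c u t +
      v t \<bullet>\<^sub>r\<^sub>c (u' t - rs_integral_col (-r) 0 \<eta> (\<lambda>\<theta>. u (t + \<theta>)))" for t
  proof -
    have "(\<Sum>i\<in>UNIV. \<Sum>j\<in>UNIV. R t i j * u t $ j) = (\<Sum>j\<in>UNIV. \<Sum>i\<in>UNIV. R t i j * u t $ j)"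
      by (rule sum.swap)
    then show ?thesis
      unfolding D_def rs_integral_row_def rs_integral_col_def row_times_col_def R_def[symmetric] C_def[symmetric]
      by (simp add: sum.distrib sum_subtractf sum_distrib_left sum_distrib_right algebra_simps)
  qed
  ultimately show ?thesis
    using D_cont by blast
qed

end
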